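(* Let $n\ge 3$ be an odd integer and $G=\langle\sigma,\tau:\sigma^n=\tau^2=1,\ \tau\sigma\tau^{-1}=\sigma^{-1}\rangle\simeq D_n$. Then there is an isomorphism of $G$-lattices $\widetilde{M}_+\oplus\mathbb{Z}\simeq\mathbb{Z}[G/\langle\sigma\rangle]\oplus\mathbb{Z}[G/\langle\tau\rangle]$.
   Context: $D_n$ is the dihedral group of order $2n$. A $G$-lattice is a finitely generated $\mathbb{Z}[G]$-module that is torsion-free as an abelian group; $\mathbb{Z}$ denotes the rank-one lattice with trivial $G$-action, and for a subgroup $S\le G$, $\mathbb{Z}[G/S]$ is the permutation lattice on the left cosets of $S$. The $G$-lattice $\widetilde{M}_+$ of rank $n+1$ is the free abelian group with basis $w_0,\ldots,w_{n-1},w$ (indices modulo $n$) and action $\sigma\cdot w_i=w_{i+1}$, $\tau\cdot w_i=w_{-i}$, $\sigma\cdot w=w$, $\tau\cdot w=-w+\sum_{0\le i\le n-1}w_i$. *)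

theory Defs
  imports "HOL-Algebra.Algebra"
begin

section \<open>Dihedral groups\<close>

text \<open>
  The relations together with generation make the group a quotient of the group presented by
  \<open>\<langle>\<sigma>, \<tau> | \<sigma>\<^sup>n = \<tau>\<^sup>2 = 1, \<tau> \<sigma> \<tau>\<^sup>-\<^sup>1 = \<sigma>\<^sup>-\<^sup>1\<rangle>\<close>, which has order \<open>2 n\<close>; the condition on the order
  says that no further relation holds.
\<close>

locale dihedral_group = group G for G (structure) +
  fixes \<sigma> \<tau> :: 'a and n :: nat
  assumes sigma_closed: "\<sigma> \<in> carrier G"
    and tau_closed: "\<tau> \<in> carrier G"
    and generated: "carrier G = generate G {\<sigma>, \<tau>}"
    and sigma_pow: "\<sigma> [^] n = \<one>"
    and tau_pow: "\<tau> [^] (2::nat) = \<one>"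
    and conj_rel: "\<tau> \<otimes> \<sigma> \<otimes> inv \<tau> = inv \<sigma>"
    and order_eq: "order G = 2 * n"


section \<open>Lattices over a group\<close>

text \<open>
  A \<open>\<int>[G]\<close>-module is an abelian group (written multiplicatively, as everywhere in HOL-Algebra)
  with a \<open>G\<close>-action by group endomorphisms.  Only the values of \<^term>\<open>act\<close> on the carriers matter.
\<close>

record ('g, 'a) gmodule = "'a monoid" +
  act :: "'g \<Rightarrow> 'a \<Rightarrow> 'a"

locale group_module = G: group G + M: comm_group M
  for G :: "('g, 'r) monoid_scheme" and M :: "('g, 'a, 's) gmodule_scheme" +
  assumes act_hom: "g \<in> carrier G \<Longrightarrow> act M g \<in> hom M M"
    and act_one: "x \<in> carrier M \<Longrightarrow> act M \<one>\<^bsub>G\<^esub> x = x"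
    and act_mult: "\<lbrakk>g \<in> carrier G; h \<in> carrier G; x \<in> carrier M\<rbrakk>
          \<Longrightarrow> act M (g \<otimes>\<^bsub>G\<^esub> h) x = act M g (act M h x)"

text \<open>
  The \<open>\<int>[G]\<close>-submodule generated by \<open>S\<close> is the subgroup generated by all \<open>g \<cdot> s\<close>.
\<close>

locale group_lattice = group_module G M
  for G :: "('g, 'r) monoid_scheme" and M :: "('g, 'a, 's) gmodule_scheme" +
  assumes finitely_generated:
      "\<exists>S. finite S \<and> S \<subseteq> carrier M
         \<and> carrier M = generate M {act M g s | g s. g \<in> carrier G \<and> s \<in> S}"
    and torsion_free:
      "\<lbrakk>x \<in> carrier M; (k::nat) > 0; x [^]\<^bsub>M\<^esub> k = \<one>\<^bsub>M\<^esub>\<rbrakk> \<Longrightarrow> x = \<one>\<^bsub>M\<^esub>"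

definition lattice_isomorphism ::
  "('g, 'r) monoid_scheme \<Rightarrow> ('g, 'a, 's) gmodule_scheme \<Rightarrow> ('g, 'b, 't) gmodule_scheme
    \<Rightarrow> ('a \<Rightarrow> 'b) \<Rightarrow> bool" where
  "lattice_isomorphism G M N f \<longleftrightarrow>
     f \<in> iso M N \<and> (\<forall>g \<in> carrier G. \<forall>x \<in> carrier M. f (act M g x) = act N g (f x))"

definition isomorphic_lattices ::
  "('g, 'r) monoid_scheme \<Rightarrow> ('g, 'a, 's) gmodule_scheme \<Rightarrow> ('g, 'b, 't) gmodule_scheme \<Rightarrow> bool"
  where
  "isomorphic_lattices G M N \<longleftrightarrow>
     group_lattice G M \<and> group_lattice G N \<and> (\<exists>f. lattice_isomorphism G M N f)"

definition with_action :: "'a monoid \<Rightarrow> ('g \<Rightarrow> 'a \<Rightarrow> 'a) \<Rightarrow> ('g, 'a) gmodule" where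
  "with_action A \<rho> = \<lparr>carrier = carrier A, monoid.mult = monoid.mult A, one = one A, act = \<rho>\<rparr>"

definition direct_sum ::
  "('g, 'a, 's) gmodule_scheme \<Rightarrow> ('g, 'b, 't) gmodule_scheme \<Rightarrow> ('g, 'a \<times> 'b) gmodule" where
  "direct_sum M N = with_action (M \<times>\<times> N) (\<lambda>g. map_prod (act M g) (act N g))"

definition trivial_lattice :: "('g, int) gmodule" where
  "trivial_lattice = with_action integer_group (\<lambda>g x. x)"

definition permutation_lattice ::
  "('g, 'r) monoid_scheme \<Rightarrow> 'g set \<Rightarrow> ('g, 'g set \<Rightarrow>\<^sub>0 int) gmodule" where
  "permutation_lattice G S =
     with_action (free_Abelian_group (lcosets\<^bsub>G\<^esub> S)) (\<lambda>g. frag_extend (\<lambda>C. frag_of (g <#\<^bsub>G\<^esub> C)))"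


section \<open>The lattice of rank \<open>n + 1\<close>\<close>

text \<open>
  \<open>Wi i\<close> for \<open>0 \<le> i < n\<close> and \<open>W\<close> stand for the basis vectors \<open>w\<^sub>i\<close> and \<open>w\<close>.
\<close>

datatype basis = Wi int | W

definition Mplus_basis :: "nat \<Rightarrow> basis set" where
  "Mplus_basis n = insert W (Wi ` {0..<int n})"

definition Mplus_sigma :: "nat \<Rightarrow> (basis \<Rightarrow>\<^sub>0 int) \<Rightarrow> (basis \<Rightarrow>\<^sub>0 int)" where
  "Mplus_sigma n = frag_extend (\<lambda>b. case b of
       Wi i \<Rightarrow> frag_of (Wi ((i + 1) mod int n))
     | W \<Rightarrow> frag_of W)"

definition Mplus_tau :: "nat \<Rightarrow> (basis \<Rightarrow>\<^sub>0 int) \<Rightarrow> (basis \<Rightarrow>\<^sub>0 int)" where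
  "Mplus_tau n = frag_extend (\<lambda>b. case b of
       Wi i \<Rightarrow> frag_of (Wi ((- i) mod int n))
     | W \<Rightarrow> - frag_of W + (\<Sum>i\<in>{0..<int n}. frag_of (Wi i)))"

text \<open>
  The action of \<open>g\<close> is read off from any expression \<open>g = \<sigma>\<^sup>i \<tau>\<^sup>j\<close>; by the lemma
  \<open>Mplus_act_word\<close> below the choice does not matter on the lattice, and by \<open>Mplus_act_basis\<close>
  \<open>\<sigma>\<close>, \<open>\<tau>\<close> act as prescribed.
\<close>

definition Mplus_act ::
  "('g, 'r) monoid_scheme \<Rightarrow> 'g \<Rightarrow> 'g \<Rightarrow> nat \<Rightarrow> 'g \<Rightarrow> (basis \<Rightarrow>\<^sub>0 int) \<Rightarrow> (basis \<Rightarrow>\<^sub>0 int)" where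
  "Mplus_act G \<sigma> \<tau> n g =
     (let (i, j) = (SOME (i, j). g = \<sigma> [^]\<^bsub>G\<^esub> (i::nat) \<otimes>\<^bsub>G\<^esub> \<tau> [^]\<^bsub>G\<^esub> (j::nat))
      in (Mplus_sigma n ^^ i) \<circ> (Mplus_tau n ^^ j))"

definition Mplus_lattice ::
  "('g, 'r) monoid_scheme \<Rightarrow> 'g \<Rightarrow> 'g \<Rightarrow> nat \<Rightarrow> ('g, basis \<Rightarrow>\<^sub>0 int) gmodule" where
  "Mplus_lattice G \<sigma> \<tau> n =
     with_action (free_Abelian_group (Mplus_basis n)) (Mplus_act G \<sigma> \<tau> n)"

subsection \<open>Well-definedness of the action\<close>

lemma Mplus_sigma_basis [simp]:
  "Mplus_sigma n (frag_of (Wi i)) = frag_of (Wi ((i + 1) mod int n))"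
  "Mplus_sigma n (frag_of W) = frag_of W"
  by (simp_all add: Mplus_sigma_def)

lemma Mplus_tau_basis [simp]:
  "Mplus_tau n (frag_of (Wi i)) = frag_of (Wi ((- i) mod int n))"
  "Mplus_tau n (frag_of W) = - frag_of W + (\<Sum>i\<in>{0..<int n}. frag_of (Wi i))"
  by (simp_all add: Mplus_tau_def)

lemma Mplus_sigma_funpow_diff:
  "(Mplus_sigma n ^^ k) (x - y) = (Mplus_sigma n ^^ k) x - (Mplus_sigma n ^^ k) y"
  by (induction k) (simp_all add: Mplus_sigma_def frag_extend_diff)

lemma Mplus_tau_diff: "Mplus_tau n (x - y) = Mplus_tau n x - Mplus_tau n y"
  by (simp add: Mplus_tau_def frag_extend_diff)

lemma Mplus_sigma_funpow_0: "(Mplus_sigma n ^^ k) 0 = 0"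
  by (induction k) (simp_all add: Mplus_sigma_def)

lemma Mplus_sigma_funpow_Wi:
  assumes "0 \<le> i" "i < int n"
  shows "(Mplus_sigma n ^^ k) (frag_of (Wi i)) = frag_of (Wi ((i + int k) mod int n))"
  by (induction k) (simp_all add: assms mod_simps add_ac)

lemma Mplus_sigma_funpow_W: "(Mplus_sigma n ^^ k) (frag_of W) = frag_of W"
  by (induction k) simp_all

lemma Mplus_sigma_order:
  assumes "x \<in> carrier (free_Abelian_group (Mplus_basis n))"
  shows "(Mplus_sigma n ^^ n) x = x"
proof -
  have "Poly_Mapping.keys x \<subseteq> Mplus_basis n"
    using assms by simp
  then show ?thesis
    by (induction rule: free_Abelian_group_induct[where S = "Mplus_basis n", consumes 1])
      (auto simp: Mplus_sigma_funpow_0 Mplus_sigma_funpow_diff Mplus_basis_def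
        Mplus_sigma_funpow_Wi Mplus_sigma_funpow_W)
qed

lemma Mplus_tau_order:
  assumes "x \<in> carrier (free_Abelian_group (Mplus_basis n))"
  shows "Mplus_tau n (Mplus_tau n x) = x"
proof -
  have *: "(- ((- i) mod int n)) mod int n = i" if "i \<in> {0..<int n}" for i
    using that by (simp add: mod_minus_eq)
  have bij: "bij_betw (\<lambda>i. (- i) mod int n) {0..<int n} {0..<int n}"
    by (rule bij_betwI[where g = "\<lambda>i. (- i) mod int n"]) (use * in auto)
  have W: "Mplus_tau n (Mplus_tau n (frag_of W)) = frag_of W"
  proof -
    have "Mplus_tau n (\<Sum>i\<in>{0..<int n}. frag_of (Wi i))
        = (\<Sum>i\<in>{0..<int n}. frag_of (Wi ((- i) mod int n)))"
      unfolding Mplus_tau_def by (subst frag_extend_sum) (auto simp: o_def)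
    also have "\<dots> = (\<Sum>i\<in>{0..<int n}. frag_of (Wi i))"
      by (rule sum.reindex_bij_betw[OF bij])
    finally have "Mplus_tau n ((\<Sum>i\<in>{0..<int n}. frag_of (Wi i)) - frag_of W) = frag_of W"
      by (simp add: Mplus_tau_diff)
    then show ?thesis
      by simp
  qed
  have "Poly_Mapping.keys x \<subseteq> Mplus_basis n"
    using assms by simp
  then show ?thesis
  proof (induction rule: free_Abelian_group_induct[where S = "Mplus_basis n", consumes 1])
    case (3 a)
    then show ?case
      using W * by (auto simp: Mplus_basis_def simp del: Mplus_tau_basis(2))
  qed (simp_all add: Mplus_tau_diff, simp add: Mplus_tau_def)
qed

lemma Mplus_sigma_funpow_mod:
  assumes "x \<in> carrier (free_Abelian_group (Mplus_basis n))"
  shows "(Mplus_sigma n ^^ k) x = (Mplus_sigma n ^^ (k mod n)) x"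
proof -
  have "((Mplus_sigma n ^^ n) ^^ q) x = x" for q
    by (induction q) (simp_all add: Mplus_sigma_order[OF assms])
  then have "(Mplus_sigma n ^^ (r + n * q)) x = (Mplus_sigma n ^^ r) x" for r q
    by (simp add: funpow_add funpow_mult)
  from this[of "k mod n" "k div n"] show ?thesis
    by simp
qed

lemma Mplus_tau_funpow_mod:
  assumes "x \<in> carrier (free_Abelian_group (Mplus_basis n))"
  shows "(Mplus_tau n ^^ k) x = (Mplus_tau n ^^ (k mod 2)) x"
proof -
  have "((Mplus_tau n ^^ 2) ^^ q) x = x" for q
    by (induction q) (simp_all add: Mplus_tau_order[OF assms] numeral_2_eq_2)
  then have "(Mplus_tau n ^^ (r + 2 * q)) x = (Mplus_tau n ^^ r) x" for r q
    by (simp add: funpow_add funpow_mult)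
  from this[of "k mod 2" "k div 2"] show ?thesis
    by simp
qed

lemma Mplus_tau_closed:
  assumes "n > 0" "x \<in> carrier (free_Abelian_group (Mplus_basis n))"
  shows "Mplus_tau n x \<in> carrier (free_Abelian_group (Mplus_basis n))"
proof -
  let ?A = "free_Abelian_group (Mplus_basis n)"
  interpret A: group ?A by simp
  have sub: "u - v \<in> carrier ?A" if "u \<in> carrier ?A" "v \<in> carrier ?A" for u v
    using that keys_diff[of u v] by (simp add: subset_iff) blast
  have "Poly_Mapping.keys x \<subseteq> Mplus_basis n"
    using assms by simp
  then show ?thesis
  proof (induction rule: free_Abelian_group_induct[where S = "Mplus_basis n", consumes 1])
    case 1
    show ?case by (simp add: Mplus_tau_def)
  next
    case (2 x y)
    then show ?case unfolding Mplus_tau_diff by (rule_tac sub)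
  next
    case (3 a)
    have s: "(\<Sum>i\<in>{0..<int n}. frag_of (Wi i)) \<in> carrier ?A"
      by (rule sum_closed_free_Abelian_group) (auto simp: Mplus_basis_def)
    have "(\<Sum>i\<in>{0..<int n}. frag_of (Wi i)) - frag_of W \<in> carrier ?A"
      by (rule sub[OF s]) (simp add: Mplus_basis_def)
    then show ?case
      using 3 assms(1) by (auto simp: Mplus_basis_def)
  qed
qed

context dihedral_group
begin

lemma sigma_pow_mod: "\<sigma> [^] (k mod n) = \<sigma> [^] (k::nat)"
proof -
  have "\<sigma> [^] (r + n * q) = \<sigma> [^] r" for r q :: nat
    using sigma_closed sigma_pow
    by (simp add: nat_pow_mult[symmetric] nat_pow_pow[symmetric])
  from this[of "k mod n" "k div n"] show ?thesis
    by simp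
qed

lemma tau_pow_mod: "\<tau> [^] (k mod 2) = \<tau> [^] (k::nat)"
proof -
  have "\<tau> [^] (r + 2 * q) = \<tau> [^] r" for r q :: nat
    using tau_closed tau_pow
    by (simp add: nat_pow_mult[symmetric] nat_pow_pow[symmetric])
  from this[of "k mod 2" "k div 2"] show ?thesis
    by simp
qed

lemma inv_sigma: "n > 0 \<Longrightarrow> inv \<sigma> = \<sigma> [^] (n - 1)"
  using sigma_closed sigma_pow
  by (intro inv_equality) (auto simp flip: nat_pow_Suc)

lemma inv_tau: "inv \<tau> = \<tau>"
  using tau_closed tau_pow by (intro inv_equality) (auto simp: numeral_2_eq_2)

lemma tau_sigma_pow:
  assumes "n > 0"
  shows "\<tau> \<otimes> \<sigma> [^] i = \<sigma> [^] ((n - 1) * i) \<otimes> \<tau>"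
proof (induction i)
  case 0
  then show ?case using tau_closed by simp
next
  case (Suc i)
  have ts: "\<tau> \<otimes> \<sigma> = \<sigma> [^] (n - 1) \<otimes> \<tau>"
    using conj_rel inv_sigma[OF assms] sigma_closed tau_closed
    by (metis inv_closed inv_solve_right m_closed)
  have "\<tau> \<otimes> \<sigma> [^] Suc i = (\<tau> \<otimes> \<sigma> [^] i) \<otimes> \<sigma>"
    using sigma_closed tau_closed by (simp add: m_assoc)
  also have "\<dots> = \<sigma> [^] ((n - 1) * i) \<otimes> (\<tau> \<otimes> \<sigma>)"
    using sigma_closed tau_closed by (simp add: Suc m_assoc)
  also have "\<dots> = \<sigma> [^] ((n - 1) * i + (n - 1)) \<otimes> \<tau>"
    using sigma_closed tau_closed by (simp add: ts m_assoc nat_pow_mult[symmetric])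
  finally show ?case
    by (simp add: add.commute)
qed

lemma word_exists:
  assumes "n > 0" "g \<in> carrier G"
  shows "\<exists>i j. g = \<sigma> [^] (i::nat) \<otimes> \<tau> [^] (j::nat)"
proof -
  have push: "\<exists>k::nat. \<tau> [^] j \<otimes> \<sigma> [^] i = \<sigma> [^] k \<otimes> \<tau> [^] j" for i j :: nat
  proof (induction j arbitrary: i)
    case 0
    have "\<tau> [^] (0::nat) \<otimes> \<sigma> [^] i = \<sigma> [^] i \<otimes> \<tau> [^] (0::nat)"
      using sigma_closed by simp
    then show ?case by blast
  next
    case (Suc j)
    obtain k :: nat where k: "\<tau> [^] j \<otimes> \<sigma> [^] ((n - 1) * i) = \<sigma> [^] k \<otimes> \<tau> [^] j"
      using Suc by blast
    have "\<tau> [^] Suc j \<otimes> \<sigma> [^] i = \<tau> [^] j \<otimes> \<sigma> [^] ((n - 1) * i) \<otimes> \<tau>"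
      using sigma_closed tau_closed by (simp add: m_assoc tau_sigma_pow[OF assms(1)])
    also have "\<dots> = \<sigma> [^] k \<otimes> \<tau> [^] Suc j"
      using sigma_closed tau_closed by (simp only: k) (simp add: m_assoc)
    finally show ?case by blast
  qed
  have "g \<in> generate G {\<sigma>, \<tau>}"
    using assms generated by simp
  then show ?thesis
  proof induction
    case one
    have "\<one> = \<sigma> [^] (0::nat) \<otimes> \<tau> [^] (0::nat)" by simp
    then show ?case by blast
  next
    case (incl h)
    have "\<sigma> = \<sigma> [^] (1::nat) \<otimes> \<tau> [^] (0::nat)" "\<tau> = \<sigma> [^] (0::nat) \<otimes> \<tau> [^] (1::nat)"
      using sigma_closed tau_closed by simp_all
    then show ?case using incl by blast
  next
    case (inv h)
    have "inv \<sigma> = \<sigma> [^] (n - 1) \<otimes> \<tau> [^] (0::nat)" "inv \<tau> = \<sigma> [^] (0::nat) \<otimes> \<tau> [^] (1::nat)"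
      using sigma_closed tau_closed inv_sigma[OF assms(1)] inv_tau by simp_all
    then show ?case using inv by blast
  next
    case (eng h1 h2)
    then obtain a b c d :: nat where h: "h1 = \<sigma> [^] a \<otimes> \<tau> [^] b" "h2 = \<sigma> [^] c \<otimes> \<tau> [^] d"
      by blast
    obtain k :: nat where k: "\<tau> [^] b \<otimes> \<sigma> [^] c = \<sigma> [^] k \<otimes> \<tau> [^] b"
      using push by blast
    have "h1 \<otimes> h2 = \<sigma> [^] a \<otimes> (\<tau> [^] b \<otimes> \<sigma> [^] c) \<otimes> \<tau> [^] d"
      using sigma_closed tau_closed by (simp add: h m_assoc)
    also have "\<dots> = (\<sigma> [^] a \<otimes> \<sigma> [^] k) \<otimes> (\<tau> [^] b \<otimes> \<tau> [^] d)"
      using sigma_closed tau_closed by (simp add: k m_assoc)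
    also have "\<dots> = \<sigma> [^] (a + k) \<otimes> \<tau> [^] (b + d)"
      using sigma_closed tau_closed by (simp add: nat_pow_mult)
    finally show ?case by blast
  qed
qed

lemma word_unique:
  fixes i j k l :: nat
  assumes "n > 0" "\<sigma> [^] i \<otimes> \<tau> [^] j = \<sigma> [^] k \<otimes> \<tau> [^] l"
  shows "i mod n = k mod n" "j mod 2 = l mod 2"
proof -
  let ?f = "\<lambda>(i::nat, j::nat). \<sigma> [^] i \<otimes> \<tau> [^] j"
  let ?D = "{..<n} \<times> {..<2::nat}"
  have red: "\<sigma> [^] i \<otimes> \<tau> [^] j = ?f (i mod n, j mod 2)" for i j :: nat
    by (simp add: sigma_pow_mod tau_pow_mod)
  have "carrier G = ?f ` ?D"
  proof
    show "carrier G \<subseteq> ?f ` ?D"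
    proof
      fix g assume "g \<in> carrier G"
      then obtain i j :: nat where "g = \<sigma> [^] i \<otimes> \<tau> [^] j"
        using word_exists[OF assms(1)] by blast
      then have "g = ?f (i mod n, j mod 2)" using red by (rule trans)
      then show "g \<in> ?f ` ?D" by (rule image_eqI) (use assms(1) in simp)
    qed
    show "?f ` ?D \<subseteq> carrier G"
      using sigma_closed tau_closed by auto
  qed
  then have "card (?f ` ?D) = card ?D"
    using order_eq by (simp add: order_def card_cartesian_product)
  then have inj: "inj_on ?f ?D"
    by (intro eq_card_imp_inj_on) auto
  have "(i mod n, j mod 2) = (k mod n, l mod 2)"
    by (rule inj_onD[OF inj]) (use assms red[of i j] red[of k l] in auto)
  then show "i mod n = k mod n" "j mod 2 = l mod 2"
    by auto
qed

lemma Mplus_act_word: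
  assumes "n > 0" "x \<in> carrier (free_Abelian_group (Mplus_basis n))"
  shows "Mplus_act G \<sigma> \<tau> n (\<sigma> [^] i \<otimes> \<tau> [^] j) x = (Mplus_sigma n ^^ i) ((Mplus_tau n ^^ j) x)"
proof -
  let ?P = "\<lambda>(k::nat, l::nat). \<sigma> [^] i \<otimes> \<tau> [^] j = \<sigma> [^] k \<otimes> \<tau> [^] l"
  obtain k l where kl: "(SOME p. ?P p) = (k, l)"
    by (cases "SOME p. ?P p")
  have "?P (SOME p. ?P p)"
    by (rule someI[of ?P "(i, j)"]) simp
  then have eq: "\<sigma> [^] i \<otimes> \<tau> [^] j = \<sigma> [^] k \<otimes> \<tau> [^] l"
    by (simp add: kl)
  have tau: "(Mplus_tau n ^^ l) x = (Mplus_tau n ^^ j) x"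
    using Mplus_tau_funpow_mod[OF assms(2)] word_unique(2)[OF assms(1) eq] by metis
  have "(Mplus_tau n ^^ j) x \<in> carrier (free_Abelian_group (Mplus_basis n))"
    using assms by (induction j) (simp_all add: Mplus_tau_closed del: carrier_free_Abelian_group_iff)
  then have "(Mplus_sigma n ^^ k) ((Mplus_tau n ^^ j) x) = (Mplus_sigma n ^^ i) ((Mplus_tau n ^^ j) x)"
    using Mplus_sigma_funpow_mod word_unique(1)[OF assms(1) eq] by metis
  then show ?thesis
    by (simp add: Mplus_act_def kl tau)
qed

lemma Mplus_act_basis:
  assumes "n > 0" "0 \<le> i" "i < int n"
  shows "act (Mplus_lattice G \<sigma> \<tau> n) \<sigma> (frag_of (Wi i)) = frag_of (Wi ((i + 1) mod int n))"
    and "act (Mplus_lattice G \<sigma> \<tau> n) \<tau> (frag_of (Wi i)) = frag_of (Wi ((- i) mod int n))"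
    and "act (Mplus_lattice G \<sigma> \<tau> n) \<sigma> (frag_of W) = frag_of W"
    and "act (Mplus_lattice G \<sigma> \<tau> n) \<tau> (frag_of W)
           = - frag_of W + (\<Sum>i\<in>{0..<int n}. frag_of (Wi i))"
  using Mplus_act_word[OF assms(1), of "frag_of (Wi i)" 1 0]
    Mplus_act_word[OF assms(1), of "frag_of (Wi i)" 0 1]
    Mplus_act_word[OF assms(1), of "frag_of W" 1 0]
    Mplus_act_word[OF assms(1), of "frag_of W" 0 1]
    assms sigma_closed tau_closed
  by (simp_all add: Mplus_lattice_def with_action_def Mplus_basis_def)

end

end

theory Submission
  imports Defs
begin

text \<open>
  Write \<open>n = 2 m + 1\<close>, let \<open>c\<^sub>0, c\<^sub>1\<close> be the two cosets of \<open>\<langle>\<sigma>\<rangle>\<close> and \<open>v\<^sub>i = \<sigma>\<^sup>i\<langle>\<tau>\<rangle>\<close>, and put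
  \<open>E = c\<^sub>0 + c\<^sub>1\<close>, \<open>N = \<Sum> v\<^sub>i\<close>, \<open>z = E + N\<close>.  The isomorphism is
  \<open>w\<^sub>i \<mapsto> v\<^sub>i + z\<close>, \<open>w \<mapsto> m z + N + c\<^sub>0\<close>, \<open>1 \<mapsto> z\<close>.  It respects \<open>\<tau>\<close> because
  \<open>w + \<tau> w \<mapsto> (2 m + 1) E + (2 m + 2) N = n z + N\<close>, the image of \<open>\<Sum> w\<^sub>i\<close>.  Its inverse is
  \<open>v\<^sub>i \<mapsto> w\<^sub>i - 1\<close>, \<open>c\<^sub>0 \<mapsto> w - \<Sum> w\<^sub>i + (m + 1)\<close>, \<open>c\<^sub>1 \<mapsto> - w + (m + 1)\<close>, where integers
  are elements of the summand \<open>\<int>\<close>.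
\<close>

section \<open>Lattices and their direct sums\<close>

lemma with_action_simps [simp]:
  "carrier (with_action A \<rho>) = carrier A"
  "x \<otimes>\<^bsub>with_action A \<rho>\<^esub> y = x \<otimes>\<^bsub>A\<^esub> y"
  "\<one>\<^bsub>with_action A \<rho>\<^esub> = \<one>\<^bsub>A\<^esub>"
  "act (with_action A \<rho>) = \<rho>"
  by (simp_all add: with_action_def)

lemma pow_with_action [simp]: "x [^]\<^bsub>with_action A \<rho>\<^esub> (k::nat) = x [^]\<^bsub>A\<^esub> k"
  by (induction k) simp_all

lemma comm_group_with_action: "comm_group A \<Longrightarrow> comm_group (with_action A \<rho>)"
proof -
  assume "comm_group A"
  then interpret comm_group A .
  show ?thesis
  proof (rule comm_groupI)
    fix x y assume "x \<in> carrier (with_action A \<rho>)" "y \<in> carrier (with_action A \<rho>)"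
    then show "x \<otimes>\<^bsub>with_action A \<rho>\<^esub> y = y \<otimes>\<^bsub>with_action A \<rho>\<^esub> x"
      by (simp add: m_comm)
  qed (auto simp: m_assoc l_inv_ex)
qed

lemma hom_with_action [simp]: "hom (with_action A \<rho>) (with_action B \<rho>') = hom A B"
  by (simp add: hom_def)

lemma inv_with_action: "inv\<^bsub>with_action A \<rho>\<^esub> x = inv\<^bsub>A\<^esub> x"
  by (simp add: m_inv_def)

section \<open>Direct sums of modules and of lattices\<close>

lemma direct_sum_simps [simp]:
  "carrier (direct_sum M N) = carrier M \<times> carrier N"
  "p \<otimes>\<^bsub>direct_sum M N\<^esub> q = (fst p \<otimes>\<^bsub>M\<^esub> fst q, snd p \<otimes>\<^bsub>N\<^esub> snd q)"
  "\<one>\<^bsub>direct_sum M N\<^esub> = (\<one>\<^bsub>M\<^esub>, \<one>\<^bsub>N\<^esub>)"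
  "act (direct_sum M N) g = map_prod (act M g) (act N g)"
  by (simp_all add: direct_sum_def DirProd_def case_prod_beta)

lemma pow_direct_sum:
  "p [^]\<^bsub>direct_sum M N\<^esub> (k::nat) = (fst p [^]\<^bsub>M\<^esub> k, snd p [^]\<^bsub>N\<^esub> k)"
  by (induction k) simp_all

lemma group_module_direct_sum:
  assumes "group_module G M" "group_module G N"
  shows "group_module G (direct_sum M N)"
proof -
  interpret M: group_module G M by fact
  interpret N: group_module G N by fact
  have "comm_group (direct_sum M N)"
  proof (rule comm_groupI)
    fix x assume "x \<in> carrier (direct_sum M N)"
    then show "\<exists>y\<in>carrier (direct_sum M N). y \<otimes>\<^bsub>direct_sum M N\<^esub> x = \<one>\<^bsub>direct_sum M N\<^esub>"
      by (intro bexI[where x = "(inv\<^bsub>M\<^esub> fst x, inv\<^bsub>N\<^esub> snd x)"]) auto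
  next
    fix x y assume "x \<in> carrier (direct_sum M N)" "y \<in> carrier (direct_sum M N)"
    then show "x \<otimes>\<^bsub>direct_sum M N\<^esub> y = y \<otimes>\<^bsub>direct_sum M N\<^esub> x"
      by (auto simp: M.M.m_comm N.M.m_comm)
  qed (auto simp: M.M.m_assoc N.M.m_assoc)
  moreover have "map_prod (act M g) (act N g) \<in> hom (direct_sum M N) (direct_sum M N)"
    if "g \<in> carrier G" for g
    using M.act_hom[OF that] N.act_hom[OF that] by (auto simp: hom_def)
  ultimately show ?thesis
    by (intro group_module.intro group_module_axioms.intro)
      (auto simp: M.act_one N.act_one M.act_mult N.act_mult M.G.group_axioms)
qed

text \<open>Products, inverses and the neutral element of the direct sum are formed componentwise,
  so each summand embeds along its axis. Finite generation of the sum follows, since (x, y) is the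
  product of (x, 1) and (1, y).\<close>

lemma generate_direct_sum_axis:
  assumes "comm_group M" "comm_group N" "comm_group (direct_sum M N)" "A \<subseteq> carrier M" "B \<subseteq> carrier N"
  shows "x \<in> generate M A \<Longrightarrow> (x, \<one>\<^bsub>N\<^esub>) \<in> generate (direct_sum M N) (A \<times> {\<one>\<^bsub>N\<^esub>} \<union> {\<one>\<^bsub>M\<^esub>} \<times> B)"
    and "y \<in> generate N B \<Longrightarrow> (\<one>\<^bsub>M\<^esub>, y) \<in> generate (direct_sum M N) (A \<times> {\<one>\<^bsub>N\<^esub>} \<union> {\<one>\<^bsub>M\<^esub>} \<times> B)"
proof -
  interpret M: comm_group M by fact
  interpret N: comm_group N by fact
  interpret D: comm_group "direct_sum M N" by fact
  let ?S = "A \<times> {\<one>\<^bsub>N\<^esub>} \<union> {\<one>\<^bsub>M\<^esub>} \<times> B"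
  have inv_D: "inv\<^bsub>direct_sum M N\<^esub> (x, y) = (inv\<^bsub>M\<^esub> x, inv\<^bsub>N\<^esub> y)"
    if "x \<in> carrier M" "y \<in> carrier N" for x y
    using that by (intro D.inv_equality) auto
  show "(x, \<one>\<^bsub>N\<^esub>) \<in> generate (direct_sum M N) ?S" if "x \<in> generate M A"
    using that
  proof induction
    case one
    show ?case using generate.one[of "direct_sum M N" ?S] by simp
  next
    case (incl h)
    then show ?case by (intro generate.incl) auto
  next
    case (inv h)
    then have "inv\<^bsub>direct_sum M N\<^esub> (h, \<one>\<^bsub>N\<^esub>) \<in> generate (direct_sum M N) ?S"
      by (intro generate.inv) auto
    moreover have "h \<in> carrier M" using inv assms by auto
    ultimately show ?case by (simp add: inv_D)
  next
    case (eng h k)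
    from generate.eng[OF eng.IH] show ?case by simp
  qed
  show "(\<one>\<^bsub>M\<^esub>, y) \<in> generate (direct_sum M N) ?S" if "y \<in> generate N B"
    using that
  proof induction
    case one
    show ?case using generate.one[of "direct_sum M N" ?S] by simp
  next
    case (incl h)
    then show ?case by (intro generate.incl) auto
  next
    case (inv h)
    then have "inv\<^bsub>direct_sum M N\<^esub> (\<one>\<^bsub>M\<^esub>, h) \<in> generate (direct_sum M N) ?S"
      by (intro generate.inv) auto
    moreover have "h \<in> carrier N" using inv assms by auto
    ultimately show ?case by (simp add: inv_D)
  next
    case (eng h k)
    from generate.eng[OF eng.IH] show ?case by simp
  qed
qed

lemma (in group_module) act_closed:
  "\<lbrakk>g \<in> carrier G; x \<in> carrier M\<rbrakk> \<Longrightarrow> act M g x \<in> carrier M"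
  using act_hom by (auto simp: hom_def)

lemma (in group_module) act_zero: "g \<in> carrier G \<Longrightarrow> act M g \<one>\<^bsub>M\<^esub> = \<one>\<^bsub>M\<^esub>"
  using act_hom hom_one M.is_group by blast

lemma group_lattice_direct_sum:
  assumes "group_lattice G M" "group_lattice G N"
  shows "group_lattice G (direct_sum M N)"
proof -
  interpret M: group_lattice G M by fact
  interpret N: group_lattice G N by fact
  let ?D = "direct_sum M N"
  interpret D: group_module G ?D
    by (rule group_module_direct_sum) (fact M.group_module_axioms N.group_module_axioms)+
  obtain S where S: "finite S" "S \<subseteq> carrier M"
    "carrier M = generate M {act M g s |g s. g \<in> carrier G \<and> s \<in> S}" (is "_ = generate M ?A")
    using M.finitely_generated by blast
  obtain T where T: "finite T" "T \<subseteq> carrier N"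
    "carrier N = generate N {act N g s |g s. g \<in> carrier G \<and> s \<in> T}" (is "_ = generate N ?B")
    using N.finitely_generated by blast
  define U where "U = S \<times> {\<one>\<^bsub>N\<^esub>} \<union> {\<one>\<^bsub>M\<^esub>} \<times> T"
  let ?C = "{act ?D g s |g s. g \<in> carrier G \<and> s \<in> U}"
  have U: "finite U" "U \<subseteq> carrier ?D"
    using S T by (auto simp: U_def)
  \<comment> \<open>An action by endomorphisms fixes the neutral element, so translating an element
    of \<open>U\<close> moves only the coordinate that comes from \<open>S\<close> or
    \<open>T\<close>.\<close>
  have orbit: "?A \<times> {\<one>\<^bsub>N\<^esub>} \<union> {\<one>\<^bsub>M\<^esub>} \<times> ?B \<subseteq> ?C"
  proof
    fix p assume "p \<in> ?A \<times> {\<one>\<^bsub>N\<^esub>} \<union> {\<one>\<^bsub>M\<^esub>} \<times> ?B"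
    then consider g s where "g \<in> carrier G" "s \<in> S" "p = (act M g s, \<one>\<^bsub>N\<^esub>)"
      | g s where "g \<in> carrier G" "s \<in> T" "p = (\<one>\<^bsub>M\<^esub>, act N g s)"
      by blast
    then show "p \<in> ?C"
    proof cases
      case 1
      then have "p = act ?D g (s, \<one>\<^bsub>N\<^esub>)" "(s, \<one>\<^bsub>N\<^esub>) \<in> U"
        by (simp_all add: U_def N.act_zero)
      then show ?thesis using 1 by blast
    next
      case 2
      then have "p = act ?D g (\<one>\<^bsub>M\<^esub>, s)" "(\<one>\<^bsub>M\<^esub>, s) \<in> U"
        by (simp_all add: U_def M.act_zero)
      then show ?thesis using 2 by blast
    qed
  qed
  have AB: "?A \<subseteq> carrier M" "?B \<subseteq> carrier N"
    using S(2) T(2) M.act_closed N.act_closed by auto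
  note axis = generate_direct_sum_axis[OF M.M.comm_group_axioms N.M.comm_group_axioms
      D.M.comm_group_axioms AB]
  have C: "?C \<subseteq> carrier ?D"
    using U(2) D.act_closed by blast
  have "p \<in> generate ?D ?C" if "p \<in> carrier ?D" for p
  proof -
    obtain x y where p: "p = (x, y)" "x \<in> carrier M" "y \<in> carrier N"
      using \<open>p \<in> carrier ?D\<close> by auto
    have "(x, \<one>\<^bsub>N\<^esub>) \<in> generate ?D ?C" "(\<one>\<^bsub>M\<^esub>, y) \<in> generate ?D ?C"
      using axis p S(3) T(3) D.M.mono_generate[OF orbit] by blast+
    from generate.eng[OF this] show ?thesis
      using p by simp
  qed
  then have "carrier ?D = generate ?D ?C"
    using D.M.generate_in_carrier[OF C] by blast
  then have "\<exists>S. finite S \<and> S \<subseteq> carrier ?D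
      \<and> carrier ?D = generate ?D {act ?D g s |g s. g \<in> carrier G \<and> s \<in> S}"
    using U by (intro exI[of _ U] conjI)
  moreover have "p = \<one>\<^bsub>?D\<^esub>" if "p \<in> carrier ?D" "k > 0" "p [^]\<^bsub>?D\<^esub> k = \<one>\<^bsub>?D\<^esub>" for p and k :: nat
    using that M.torsion_free N.torsion_free by (auto simp: pow_direct_sum)
  ultimately show ?thesis
    by (rule group_lattice.intro[OF D.group_module_axioms group_lattice_axioms.intro])
qed

section \<open>Lattices on free abelian groups and on the integers\<close>

lemma group_module_with_action:
  assumes "group G" "comm_group A"
    and "\<And>g. g \<in> carrier G \<Longrightarrow> \<rho> g \<in> hom A A"
    and "\<And>x. x \<in> carrier A \<Longrightarrow> \<rho> \<one>\<^bsub>G\<^esub> x = x"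
    and "\<And>g h x. \<lbrakk>g \<in> carrier G; h \<in> carrier G; x \<in> carrier A\<rbrakk> \<Longrightarrow> \<rho> (g \<otimes>\<^bsub>G\<^esub> h) x = \<rho> g (\<rho> h x)"
  shows "group_module G (with_action A \<rho>)"
  by (intro group_module.intro group_module_axioms.intro comm_group_with_action)
    (simp_all add: assms)

text \<open>The basis vectors serve as lattice generators: each \<open>frag_of b\<close> is its own
  translate by the identity of \<open>G\<close>.\<close>

lemma group_lattice_free:
  fixes B :: "'b set"
  assumes "group G" "finite B"
    and hom: "\<And>g. g \<in> carrier G \<Longrightarrow> \<rho> g \<in> hom (free_Abelian_group B) (free_Abelian_group B)"
    and one: "\<And>x. x \<in> carrier (free_Abelian_group B) \<Longrightarrow> \<rho> \<one>\<^bsub>G\<^esub> x = x"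
    and mult: "\<And>g h x. \<lbrakk>g \<in> carrier G; h \<in> carrier G; x \<in> carrier (free_Abelian_group B)\<rbrakk>
      \<Longrightarrow> \<rho> (g \<otimes>\<^bsub>G\<^esub> h) x = \<rho> g (\<rho> h x)"
  shows "group_lattice G (with_action (free_Abelian_group B) \<rho>)"
proof -
  let ?F = "free_Abelian_group B" and ?M = "with_action (free_Abelian_group B) \<rho>"
  interpret M: group_module G ?M
    by (intro group_module_with_action abelian_free_Abelian_group \<open>group G\<close> hom one mult)
  let ?C = "{act ?M g s |g s. g \<in> carrier G \<and> s \<in> frag_of ` B}"
  have sub: "frag_of ` B \<subseteq> carrier ?M"
    by auto
  then have C: "?C \<subseteq> carrier ?M"
    using M.act_closed by blast
  have inv: "inv\<^bsub>?M\<^esub> x = - x" if "Poly_Mapping.keys x \<subseteq> B" for x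
    using that by (simp add: inv_with_action)
  have "x \<in> generate ?M ?C" if "Poly_Mapping.keys x \<subseteq> B" for x
    using that
  proof (induction rule: free_Abelian_group_induct[where S = B, consumes 1])
    case 1
    show ?case using generate.one[of ?M ?C] by simp
  next
    \<comment> \<open>The induction builds elements from differences, so the inverse of
      \<open>y\<close> is needed besides the product.\<close>
    case (2 x y)
    then have "- y \<in> generate ?M ?C"
      using M.M.generate_m_inv_closed[OF C, of y] by (simp only: inv)
    from generate.eng[OF \<open>x \<in> generate ?M ?C\<close> this] show ?case
      by simp
  next
    case (3 b)
    then have "act ?M \<one>\<^bsub>G\<^esub> (frag_of b) = frag_of b"
      by (intro M.act_one) simp
    then have "frag_of b \<in> ?C"
      using 3 M.G.one_closed by (intro CollectI exI[of _ "\<one>\<^bsub>G\<^esub>"] exI[of _ "frag_of b"]) simp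
    then show ?case by (rule generate.incl)
  qed
  then have "carrier ?M = generate ?M ?C"
    using M.M.generate_in_carrier[OF C] by (intro equalityI subsetI) simp_all
  then have "\<exists>S. finite S \<and> S \<subseteq> carrier ?M
      \<and> carrier ?M = generate ?M {act ?M g s |g s. g \<in> carrier G \<and> s \<in> S}"
    using \<open>finite B\<close> sub by (intro exI[of _ "frag_of ` B"] conjI finite_imageI)
  moreover have "x = \<one>\<^bsub>?M\<^esub>" if "k > 0" "x [^]\<^bsub>?M\<^esub> k = \<one>\<^bsub>?M\<^esub>" for x and k :: nat
    using that by simp
  ultimately show ?thesis
    by (rule group_lattice.intro[OF M.group_module_axioms group_lattice_axioms.intro])
qed

lemma group_lattice_trivial:
  fixes G :: "('g, 'r) monoid_scheme"
  assumes "group G"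
  shows "group_lattice G trivial_lattice"
proof -
  let ?M = "trivial_lattice :: ('g, int) gmodule"
  interpret M: group_module G ?M
    using assms unfolding trivial_lattice_def
    by (intro group_module_with_action abelian_integer_group) (auto simp: hom_def)
  let ?C = "{act ?M g s |g s. g \<in> carrier G \<and> s \<in> {1}}"
  have C: "?C \<subseteq> carrier ?M"
    by (auto simp: trivial_lattice_def)
  have one: "1 \<in> generate ?M ?C"
    using M.G.one_closed by (intro generate.incl) (auto simp: trivial_lattice_def)
  have inv: "- k \<in> generate ?M ?C" if "k \<in> generate ?M ?C" for k
    using M.M.generate_m_inv_closed[OF C that]
    by (simp add: trivial_lattice_def inv_with_action)
  have add: "j + k \<in> generate ?M ?C" if "j \<in> generate ?M ?C" "k \<in> generate ?M ?C" for j k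
    using generate.eng[OF that] by (simp add: trivial_lattice_def)
  have "k \<in> generate ?M ?C" for k
  proof (induction k rule: int_induct[where k = 0])
    case base
    show ?case using generate.one[of ?M ?C] by (simp add: trivial_lattice_def)
  next
    case (step1 i)
    then show ?case using add[OF _ one, of i] by simp
  next
    case (step2 i)
    then show ?case using add[OF _ inv[OF one], of i] by simp
  qed
  then have "carrier ?M = generate ?M ?C"
    by (auto simp: trivial_lattice_def)
  then show ?thesis
    by (intro group_lattice.intro group_lattice_axioms.intro M.group_module_axioms
        exI[of _ "{1}"]) (auto simp: trivial_lattice_def)
qed

text \<open>Both sides are additive in \<open>x\<close> and agree on basis vectors. For permutation
  lattices this reduces the action law to (gh)C = g(hC) on cosets.\<close>

lemma frag_extend_compose_frag_of:
  "frag_extend f (frag_extend (\<lambda>b. frag_of (g b)) x) = frag_extend (\<lambda>b. f (g b)) x"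
  by (rule frag_induction[of x UNIV]) (simp_all add: frag_extend_diff)

text \<open>The carrier of a free abelian group consists of the elements supported in its basis, so
  this is the test that a linear map respects carriers.\<close>

lemma frag_extend_keys:
  assumes "\<And>b. b \<in> B \<Longrightarrow> Poly_Mapping.keys (f b) \<subseteq> C" "Poly_Mapping.keys x \<subseteq> B"
  shows "Poly_Mapping.keys (frag_extend f x) \<subseteq> C"
  using assms(2)
proof (rule frag_induction)
  show "Poly_Mapping.keys (frag_extend f (x - y)) \<subseteq> C"
    if "Poly_Mapping.keys (frag_extend f x) \<subseteq> C" "Poly_Mapping.keys (frag_extend f y) \<subseteq> C" for x y
    using that keys_diff[of "frag_extend f x" "frag_extend f y"] by (auto simp: frag_extend_diff)
qed (use assms(1) in simp_all)

lemma (in group) l_coset_in_lcosets: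
  assumes "subgroup S G" "g \<in> carrier G" "C \<in> lcosets S"
  shows "g <#\<^bsub>G\<^esub> C \<in> lcosets S"
proof -
  obtain a where "a \<in> carrier G" "C = a <#\<^bsub>G\<^esub> S"
    using assms(3) by (auto simp: LCOSETS_def)
  moreover from this have "g <#\<^bsub>G\<^esub> C = (g \<otimes> a) <#\<^bsub>G\<^esub> S"
    using assms subgroup.subset[of S G] by (simp add: lcos_m_assoc)
  ultimately show ?thesis
    using assms(2) by (auto simp: LCOSETS_def)
qed

lemma (in group) group_lattice_permutation:
  assumes "finite (carrier G)" "subgroup S G"
  shows "group_lattice G (permutation_lattice G S)"
  unfolding permutation_lattice_def
proof (rule group_lattice_free)
  have coset: "C \<subseteq> carrier G" if "C \<in> lcosets S" for C
    using that lcosets_subset_PowG[OF assms(2)] by blast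
  show "group G" ..
  show "finite (lcosets S)"
    using assms(1) by (auto simp: LCOSETS_def)
  show "frag_extend (\<lambda>C. frag_of (g <#\<^bsub>G\<^esub> C)) \<in>
      hom (free_Abelian_group (lcosets S)) (free_Abelian_group (lcosets S))"
    if "g \<in> carrier G" for g
    using that assms(2) frag_extend_keys[of "lcosets S" "\<lambda>C. frag_of (g <#\<^bsub>G\<^esub> C)" "lcosets S"]
    by (auto simp: hom_def frag_extend_add l_coset_in_lcosets)
  show "frag_extend (\<lambda>C. frag_of (\<one> <#\<^bsub>G\<^esub> C)) x = x"
    if "x \<in> carrier (free_Abelian_group (lcosets S))" for x
  proof -
    have "Poly_Mapping.keys x \<subseteq> lcosets S" using that by simp
    then show ?thesis
      by (rule frag_induction) (auto simp: frag_extend_diff coset lcos_mult_one)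
  qed
  show "frag_extend (\<lambda>C. frag_of (g \<otimes> h <#\<^bsub>G\<^esub> C)) x =
      frag_extend (\<lambda>C. frag_of (g <#\<^bsub>G\<^esub> C)) (frag_extend (\<lambda>C. frag_of (h <#\<^bsub>G\<^esub> C)) x)"
    if "g \<in> carrier G" "h \<in> carrier G" "x \<in> carrier (free_Abelian_group (lcosets S))" for g h x
    unfolding frag_extend_compose_frag_of
    by (rule frag_extend_eq) (use that coset in \<open>auto simp: lcos_m_assoc\<close>)
qed

text \<open>The group elements whose action commutes with \<open>f\<close> form a subgroup, so
  generators suffice.\<close>

lemma equivariant_if_on_generators:
  assumes "group_module G M" "group_module G N"
    and f: "f \<in> carrier M \<rightarrow> carrier N"
    and S: "S \<subseteq> carrier G" "carrier G = generate G S"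
    and eq: "\<And>g x. \<lbrakk>g \<in> S; x \<in> carrier M\<rbrakk> \<Longrightarrow> f (act M g x) = act N g (f x)"
    and gx: "g \<in> carrier G" "x \<in> carrier M"
  shows "f (act M g x) = act N g (f x)"
proof -
  interpret M: group_module G M by fact
  interpret N: group_module G N by fact
  have "g \<in> generate G S" using gx S by simp
  then show ?thesis using gx(2)
  \<comment> \<open>\<open>x\<close> is generalised because for a product h k the hypothesis for h
    is used at the point k x.\<close>
  proof (induction arbitrary: x)
    case one
    then show ?case using funcset_mem[OF f] by (simp add: M.act_one N.act_one)
  next
    case (incl h)
    then show ?case by (rule eq)
  next
    case (inv h)
    then have h: "h \<in> carrier G" "inv\<^bsub>G\<^esub> h \<in> carrier G"
      using S(1) by auto
    let ?y = "act M (inv\<^bsub>G\<^esub> h) x"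
    have y: "?y \<in> carrier M" "f ?y \<in> carrier N"
      using h inv funcset_mem[OF f] M.act_closed by simp_all
    \<comment> \<open>Write x = h (h^-1 x), move \<open>f\<close> past the generator
      \<open>h\<close>, then apply h^-1 on the side of \<open>N\<close>.\<close>
    have "f x = f (act M h ?y)"
      using h inv M.act_mult[of h "inv\<^bsub>G\<^esub> h" x] by (simp add: M.act_one)
    also have "\<dots> = act N h (f ?y)"
      using inv y by (intro eq)
    finally show ?case
      using h y N.act_mult[of "inv\<^bsub>G\<^esub> h" h "f ?y"] by (simp add: N.act_one)
  next
    case (eng h k)
    then have hk: "h \<in> carrier G" "k \<in> carrier G"
      using S(2) by auto
    then show ?case
      using eng funcset_mem[OF f] M.act_closed by (simp add: M.act_mult N.act_mult)
  qed
qed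

section \<open>The dihedral group: the lattice of rank \<open>n + 1\<close> and the coset spaces\<close>

lemma Mplus_sigma_diff: "Mplus_sigma n (x - y) = Mplus_sigma n x - Mplus_sigma n y"
  by (simp add: Mplus_sigma_def frag_extend_diff)

lemma Mplus_sigma_add: "Mplus_sigma n (x + y) = Mplus_sigma n x + Mplus_sigma n y"
  by (simp add: Mplus_sigma_def frag_extend_add)

lemma Mplus_tau_add: "Mplus_tau n (x + y) = Mplus_tau n x + Mplus_tau n y"
  by (simp add: Mplus_tau_def frag_extend_add)

lemma Mplus_sigma_closed:
  assumes "n > 0" "x \<in> carrier (free_Abelian_group (Mplus_basis n))"
  shows "Mplus_sigma n x \<in> carrier (free_Abelian_group (Mplus_basis n))"
proof -
  have "Poly_Mapping.keys (Mplus_sigma n x) \<subseteq> Mplus_basis n"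
    unfolding Mplus_sigma_def
  proof (rule frag_extend_keys)
    show "Poly_Mapping.keys x \<subseteq> Mplus_basis n" using assms(2) by simp
  qed (use assms(1) in \<open>auto simp: Mplus_basis_def\<close>)
  then show ?thesis by simp
qed

text \<open>The permutation only reorders the summands. This serves the sum of all w_i and, later,
  the sum \<open>N\<close> of the v_i.\<close>

lemma sum_frag_of_reindex:
  assumes "bij_betw p I I" "\<And>i. i \<in> I \<Longrightarrow> frag_extend f (frag_of (v i)) = frag_of (v (p i))" "finite I"
  shows "frag_extend f (\<Sum>i\<in>I. frag_of (v i)) = (\<Sum>i\<in>I. frag_of (v i))"
proof -
  have "frag_extend f (\<Sum>i\<in>I. frag_of (v i)) = (\<Sum>i\<in>I. frag_of (v (p i)))"
    using assms(2,3) by (simp add: frag_extend_sum)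
  also have "\<dots> = (\<Sum>i\<in>I. frag_of (v i))"
    by (rule sum.reindex_bij_betw[OF assms(1)])
  finally show ?thesis .
qed

lemma bij_betw_add_one_mod:
  assumes "n > 0"
  shows "bij_betw (\<lambda>i. (i + 1) mod int n) {0..<int n} {0..<int n}"
proof (rule bij_betwI[where g = "\<lambda>i. (i - 1) mod int n"])
  show "((i + 1) mod int n - 1) mod int n = i" "((i - 1) mod int n + 1) mod int n = i"
    if "i \<in> {0..<int n}" for i
    using that by (simp_all add: mod_simps)
qed (use assms in auto)

lemma bij_betw_uminus_mod:
  assumes "n > 0"
  shows "bij_betw (\<lambda>i. (- i) mod int n) {0..<int n} {0..<int n}"
proof (rule bij_betwI[where g = "\<lambda>i. (- i) mod int n"])
  show "(- ((- i) mod int n)) mod int n = i" "(- ((- i) mod int n)) mod int n = i"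
    if "i \<in> {0..<int n}" for i
    using that by (simp_all add: mod_minus_eq)
qed (use assms in auto)

lemma Mplus_sigma_sum:
  assumes "n > 0"
  shows "Mplus_sigma n (\<Sum>i\<in>{0..<int n}. frag_of (Wi i)) = (\<Sum>i\<in>{0..<int n}. frag_of (Wi i))"
  unfolding Mplus_sigma_def
  by (rule sum_frag_of_reindex[OF bij_betw_add_one_mod[OF assms]]) simp_all

text \<open>By linearity basis vectors suffice: on w_i both sides give the index -(i + k) modulo n,
  and on w both give \<open>?P\<close> - w, since sigma fixes w and \<open>?P\<close>. The factor n
  - 1 replaces -1 because iterates have natural exponents.\<close>

lemma Mplus_tau_sigma_funpow:
  assumes "n > 0" "x \<in> carrier (free_Abelian_group (Mplus_basis n))"
  shows "Mplus_tau n ((Mplus_sigma n ^^ k) x) = (Mplus_sigma n ^^ ((n - 1) * k)) (Mplus_tau n x)"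
proof -
  let ?P = "\<Sum>i\<in>{0..<int n}. frag_of (Wi i)"
  have P: "(Mplus_sigma n ^^ j) ?P = ?P" for j
    by (induction j) (simp_all add: Mplus_sigma_sum[OF assms(1)])
  have "Poly_Mapping.keys x \<subseteq> Mplus_basis n"
    using assms by simp
  then show ?thesis
  proof (induction rule: free_Abelian_group_induct[where S = "Mplus_basis n", consumes 1])
    case 1
    then show ?case by (simp add: Mplus_sigma_funpow_0 Mplus_tau_def)
  next
    case (2 x y)
    then show ?case by (simp add: Mplus_sigma_funpow_diff Mplus_tau_diff)
  next
    case (3 b)
    then consider i where "b = Wi i" "0 \<le> i" "i < int n" | "b = W"
      by (auto simp: Mplus_basis_def)
    then show ?case
    proof cases
      case 1
      have eq: "int ((n - 1) * k) = int n * int k - int k"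
        using assms(1) by (simp add: of_nat_diff algebra_simps)
      have "(- ((i + int k) mod int n)) mod int n
          = ((- i) mod int n + int ((n - 1) * k)) mod int n"
        unfolding eq mod_minus_eq mod_add_left_eq
        using mod_mult_self2[of "- i - int k" "int n" "int k"] by (simp add: algebra_simps)
      then show ?thesis
        using 1 assms(1) by (simp add: Mplus_sigma_funpow_Wi)
    next
      case 2
      then show ?thesis
        using Mplus_sigma_funpow_diff[of "(n - 1) * k" n ?P "frag_of W"]
        by (simp add: P Mplus_sigma_funpow_W)
    qed
  qed
qed

section \<open>The action of the group on the lattice of rank n + 1\<close>

context dihedral_group
begin

text \<open>As in the lemmas that follow, any word for \<open>g\<close> may replace the one picked
  by the choice operator, by \<open>Mplus_act_word\<close>; the claim then concerns iterates of the
  two operators.\<close>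

lemma Mplus_act_closed:
  assumes "n > 0" "g \<in> carrier G" "x \<in> carrier (free_Abelian_group (Mplus_basis n))"
  shows "Mplus_act G \<sigma> \<tau> n g x \<in> carrier (free_Abelian_group (Mplus_basis n))"
proof -
  obtain i j :: nat where g: "g = \<sigma> [^] i \<otimes> \<tau> [^] j"
    using word_exists[OF assms(1,2)] by blast
  have tau: "(Mplus_tau n ^^ j) x \<in> carrier (free_Abelian_group (Mplus_basis n))"
    using assms(3)
    by (induction j) (simp_all add: Mplus_tau_closed[OF assms(1)] del: carrier_free_Abelian_group_iff)
  then have "(Mplus_sigma n ^^ i) ((Mplus_tau n ^^ j) x) \<in> carrier (free_Abelian_group (Mplus_basis n))"
    by (induction i) (simp_all add: Mplus_sigma_closed[OF assms(1)] del: carrier_free_Abelian_group_iff)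
  then show ?thesis
    by (simp only: g Mplus_act_word[OF assms(1,3)])
qed

lemma Mplus_act_add:
  assumes "n > 0" "g \<in> carrier G" "x \<in> carrier (free_Abelian_group (Mplus_basis n))"
    "y \<in> carrier (free_Abelian_group (Mplus_basis n))"
  shows "Mplus_act G \<sigma> \<tau> n g (x + y) = Mplus_act G \<sigma> \<tau> n g x + Mplus_act G \<sigma> \<tau> n g y"
proof -
  obtain i j :: nat where g: "g = \<sigma> [^] i \<otimes> \<tau> [^] j"
    using word_exists[OF assms(1,2)] by blast
  have sigma: "(Mplus_sigma n ^^ k) (u + v) = (Mplus_sigma n ^^ k) u + (Mplus_sigma n ^^ k) v" for k u v
    by (induction k) (simp_all add: Mplus_sigma_add)
  have tau: "(Mplus_tau n ^^ k) (u + v) = (Mplus_tau n ^^ k) u + (Mplus_tau n ^^ k) v" for k u v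
    by (induction k) (simp_all add: Mplus_tau_add)
  have "x + y \<in> carrier (free_Abelian_group (Mplus_basis n))"
    using monoid.m_closed[OF group.is_monoid[OF group_free_Abelian_group] assms(3,4)] by simp
  then show ?thesis
    by (simp only: g Mplus_act_word[OF assms(1)] assms(3,4) sigma tau)
qed

lemma Mplus_act_sigma:
  assumes "n > 0" "x \<in> carrier (free_Abelian_group (Mplus_basis n))"
  shows "Mplus_act G \<sigma> \<tau> n \<sigma> x = Mplus_sigma n x"
  using Mplus_act_word[OF assms, of 1 0] sigma_closed by simp

lemma Mplus_act_tau:
  assumes "n > 0" "x \<in> carrier (free_Abelian_group (Mplus_basis n))"
  shows "Mplus_act G \<sigma> \<tau> n \<tau> x = Mplus_tau n x"
  using Mplus_act_word[OF assms, of 0 1] tau_closed by simp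

text \<open>Left multiplication by sigma or tau composes the action with the corresponding operator;
  peeling off the letters of a word for \<open>g\<close> one at a time gives the law for all
  products.\<close>

lemma Mplus_act_mult:
  assumes "n > 0" "g \<in> carrier G" "h \<in> carrier G" "x \<in> carrier (free_Abelian_group (Mplus_basis n))"
  shows "Mplus_act G \<sigma> \<tau> n (g \<otimes> h) x = Mplus_act G \<sigma> \<tau> n g (Mplus_act G \<sigma> \<tau> n h x)"
proof -
  let ?act = "Mplus_act G \<sigma> \<tau> n" and ?A = "free_Abelian_group (Mplus_basis n)"
  note word = Mplus_act_word[OF assms(1)]
  have sigma_step: "?act (\<sigma> \<otimes> k) x = Mplus_sigma n (?act k x)" if k: "k \<in> carrier G" for k
  proof -
    obtain i j :: nat where ij: "k = \<sigma> [^] i \<otimes> \<tau> [^] j"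
      using word_exists[OF assms(1) k] by blast
    have "\<sigma> \<otimes> k = \<sigma> [^] Suc i \<otimes> \<tau> [^] j"
      unfolding ij nat_pow_Suc2[OF sigma_closed] using sigma_closed tau_closed by (simp add: m_assoc)
    then have "?act (\<sigma> \<otimes> k) x = (Mplus_sigma n ^^ Suc i) ((Mplus_tau n ^^ j) x)"
      by (simp only: word[OF assms(4)])
    then show ?thesis
      by (simp add: ij word[OF assms(4)])
  qed
  \<comment> \<open>A leading tau must cross sigma^i to restore the normal form. The crossing in the
    group and the crossing of operators produce the same exponent (n - 1) i.\<close>
  have tau_step: "?act (\<tau> \<otimes> k) x = Mplus_tau n (?act k x)" if k: "k \<in> carrier G" for k
  proof -
    obtain i j :: nat where ij: "k = \<sigma> [^] i \<otimes> \<tau> [^] j"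
      using word_exists[OF assms(1) k] by blast
    have "\<tau> \<otimes> k = \<sigma> [^] ((n - 1) * i) \<otimes> \<tau> \<otimes> \<tau> [^] j"
      unfolding ij tau_sigma_pow[OF assms(1), symmetric] using sigma_closed tau_closed
      by (simp add: m_assoc)
    also have "\<dots> = \<sigma> [^] ((n - 1) * i) \<otimes> \<tau> [^] Suc j"
      unfolding nat_pow_Suc2[OF tau_closed] using sigma_closed tau_closed by (simp add: m_assoc)
    finally have "?act (\<tau> \<otimes> k) x = (Mplus_sigma n ^^ ((n - 1) * i)) (Mplus_tau n ((Mplus_tau n ^^ j) x))"
      by (simp only: word[OF assms(4)] funpow.simps o_apply)
    moreover have "(Mplus_tau n ^^ j) x \<in> carrier ?A"
      using assms(4)
      by (induction j) (simp_all add: Mplus_tau_closed[OF assms(1)] del: carrier_free_Abelian_group_iff)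
    ultimately show ?thesis
      by (simp only: ij word[OF assms(4)] Mplus_tau_sigma_funpow[OF assms(1)])
  qed
  obtain i j :: nat where g: "g = \<sigma> [^] i \<otimes> \<tau> [^] j"
    using word_exists[OF assms(1,2)] by blast
  have tau: "?act (\<tau> [^] j \<otimes> h) x = (Mplus_tau n ^^ j) (?act h x)" for j :: nat
  proof (induction j)
    case 0
    then show ?case using assms(3) by simp
  next
    case (Suc j)
    have "\<tau> [^] Suc j \<otimes> h = \<tau> \<otimes> (\<tau> [^] j \<otimes> h)"
      unfolding nat_pow_Suc2[OF tau_closed] using tau_closed assms(3) by (simp add: m_assoc)
    then show ?case
      using tau_step[of "\<tau> [^] j \<otimes> h"] Suc tau_closed assms(3) by simp
  qed
  have "?act (\<sigma> [^] i \<otimes> (\<tau> [^] j \<otimes> h)) x = (Mplus_sigma n ^^ i) ((Mplus_tau n ^^ j) (?act h x))" for i :: nat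
  proof (induction i)
    case 0
    then show ?case using assms(3) tau tau_closed by simp
  next
    case (Suc i)
    have "\<sigma> [^] Suc i \<otimes> (\<tau> [^] j \<otimes> h) = \<sigma> \<otimes> (\<sigma> [^] i \<otimes> (\<tau> [^] j \<otimes> h))"
      unfolding nat_pow_Suc2[OF sigma_closed] using sigma_closed tau_closed assms(3)
      by (simp add: m_assoc)
    then show ?case
      using sigma_step[of "\<sigma> [^] i \<otimes> (\<tau> [^] j \<otimes> h)"] Suc sigma_closed tau_closed assms(3) by simp
  qed
  moreover have "g \<otimes> h = \<sigma> [^] i \<otimes> (\<tau> [^] j \<otimes> h)"
    unfolding g using sigma_closed tau_closed assms(3) by (simp add: m_assoc)
  ultimately show ?thesis
    by (simp only: g word[OF Mplus_act_closed[OF assms(1,3,4)]])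
qed

lemma group_lattice_Mplus:
  assumes "n > 0"
  shows "group_lattice G (Mplus_lattice G \<sigma> \<tau> n)"
  unfolding Mplus_lattice_def
proof (rule group_lattice_free)
  let ?A = "free_Abelian_group (Mplus_basis n)"
  show "group G" ..
  show "finite (Mplus_basis n)"
    by (simp add: Mplus_basis_def)
  show "Mplus_act G \<sigma> \<tau> n g \<in> hom ?A ?A" if "g \<in> carrier G" for g
    using Mplus_act_closed[OF assms that] Mplus_act_add[OF assms that]
    by (intro homI) (simp_all only: mult_free_Abelian_group)
  show "Mplus_act G \<sigma> \<tau> n \<one> x = x" if "x \<in> carrier ?A" for x
    using Mplus_act_word[OF assms that, of 0 0] by simp
qed (fact Mplus_act_mult[OF assms])

section \<open>Integer powers of sigma and the cosets of the two cyclic subgroups\<close>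

lemma sigma_int_pow_mod: "\<sigma> [^] (i mod int n) = \<sigma> [^] (i::int)"
proof -
  have "\<sigma> [^] (int n * (i div int n)) = \<one>"
    using sigma_closed sigma_pow by (simp add: int_pow_pow[symmetric] int_pow_int)
  then show ?thesis
    using int_pow_mult[OF sigma_closed, of "int n * (i div int n)" "i mod int n"] sigma_closed
    by simp
qed

lemma sigma_int_pow_nat:
  assumes "n > 0"
  shows "\<sigma> [^] (i::int) = \<sigma> [^] nat (i mod int n)"
  using sigma_int_pow_mod[of i] assms by (simp add: pow_nat)

lemma tau_sigma_int_pow:
  assumes "n > 0"
  shows "\<tau> \<otimes> \<sigma> [^] (i::int) = \<sigma> [^] (- i) \<otimes> \<tau>"
proof -
  \<comment> \<open>The relation with natural exponents applies to the residue \<open>k\<close> of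
    \<open>i\<close>, and (n - 1) k is congruent to -i modulo n.\<close>
  define k where "k = nat (i mod int n)"
  have k: "int k = i mod int n"
    using assms by (simp add: k_def)
  have eq: "int ((n - 1) * k) = int n * int k - int k"
    using assms by (simp add: of_nat_diff algebra_simps)
  have "int ((n - 1) * k) mod int n = (- i) mod int n"
    unfolding eq using mod_mult_self2[of "- int k" "int n" "int k"]
    by (simp add: k mod_minus_eq algebra_simps)
  then have "\<sigma> [^] ((n - 1) * k) = \<sigma> [^] (- i)"
    by (metis int_pow_int sigma_int_pow_mod)
  then show ?thesis
    using tau_sigma_pow[OF assms, of k] sigma_int_pow_nat[OF assms, of i] by (simp add: k_def)
qed

text \<open>The order is 2 n > 0, whereas an infinite carrier has cardinality 0.\<close>

lemma finite_carrier: "n > 0 \<Longrightarrow> finite (carrier G)"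
  using order_eq by (metis card.infinite less_nat_zero_code nat_0_less_mult_iff order_def zero_less_numeral)

lemma subgroup_sigma: "subgroup (generate G {\<sigma>}) G"
  using sigma_closed by (intro generate_is_subgroup) simp

lemma subgroup_tau: "subgroup (generate G {\<tau>}) G"
  using tau_closed by (intro generate_is_subgroup) simp

lemma generate_sigma: "n > 0 \<Longrightarrow> generate G {\<sigma>} = {\<sigma> [^] (k::nat) | k. True}"
  using generate_pow_on_finite_carrier[OF finite_carrier sigma_closed] by simp

lemma generate_tau:
  assumes "n > 0"
  shows "generate G {\<tau>} = {\<one>, \<tau>}"
proof -
  have "\<tau> [^] k \<in> {\<one>, \<tau>}" for k :: nat
    using tau_pow_mod[of k] tau_closed by (cases "even k") (auto simp: even_iff_mod_2_eq_zero odd_iff_mod_2_eq_one)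
  then have "generate G {\<tau>} \<subseteq> {\<one>, \<tau>}"
    unfolding generate_pow_on_finite_carrier[OF finite_carrier[OF assms] tau_closed] by blast
  then show ?thesis
    using generate.one[of G "{\<tau>}"] generate.incl[of \<tau> "{\<tau>}" G] by blast
qed

text \<open>These are the v_i of the overview. Indexing by all integers lets sigma and tau act by i
  + 1 and -i; reduction modulo n enters through \<open>tau_coset_mod\<close>.\<close>

definition tau_coset :: "int \<Rightarrow> 'a set" where
  "tau_coset i = \<sigma> [^] i <#\<^bsub>G\<^esub> generate G {\<tau>}"

lemma sigma_tau_coset: "\<sigma> <#\<^bsub>G\<^esub> tau_coset i = tau_coset (i + 1)"
proof -
  have "\<sigma> \<otimes> \<sigma> [^] i = \<sigma> [^] (i + 1)"
    using sigma_closed int_pow_mult[OF sigma_closed, of 1 i] by (simp add: add.commute)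
  then show ?thesis
    unfolding tau_coset_def
    using lcos_m_assoc[OF subgroup.subset[OF subgroup_tau] sigma_closed, of "\<sigma> [^] i"] sigma_closed
    by simp
qed

text \<open>tau crosses sigma^i, inverting it, and is then absorbed by the subgroup it
  generates.\<close>

lemma tau_tau_coset:
  assumes "n > 0"
  shows "\<tau> <#\<^bsub>G\<^esub> tau_coset i = tau_coset (- i)"
proof -
  note T = subgroup.subset[OF subgroup_tau]
  have "\<tau> <#\<^bsub>G\<^esub> tau_coset i = \<sigma> [^] (- i) \<otimes> \<tau> <#\<^bsub>G\<^esub> generate G {\<tau>}"
    unfolding tau_coset_def
    using lcos_m_assoc[OF T tau_closed, of "\<sigma> [^] i"] sigma_closed
    by (simp add: tau_sigma_int_pow[OF assms])
  also have "\<dots> = \<sigma> [^] (- i) <#\<^bsub>G\<^esub> (\<tau> <#\<^bsub>G\<^esub> generate G {\<tau>})"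
    using lcos_m_assoc[OF T _ tau_closed] sigma_closed by simp
  also have "\<tau> <#\<^bsub>G\<^esub> generate G {\<tau>} = generate G {\<tau>}"
    using generate_tau[OF assms] by (intro coset_join3 tau_closed subgroup_tau) simp
  finally show ?thesis
    by (simp add: tau_coset_def)
qed

lemma tau_coset_mod: "tau_coset (i mod int n) = tau_coset i"
  by (simp add: tau_coset_def sigma_int_pow_mod)

lemma tau_coset_pair:
  assumes "n > 0"
  shows "tau_coset i = {\<sigma> [^] i, \<sigma> [^] i \<otimes> \<tau>}"
  using sigma_closed by (auto simp: tau_coset_def generate_tau[OF assms] l_coset_def)

lemma inj_on_tau_coset:
  assumes "n > 0"
  shows "inj_on tau_coset {0..<int n}"
proof (rule inj_onI)
  fix i j assume ij: "i \<in> {0..<int n}" "j \<in> {0..<int n}" "tau_coset i = tau_coset j"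
  then have "\<sigma> [^] i \<in> {\<sigma> [^] j, \<sigma> [^] j \<otimes> \<tau>}"
    by (auto simp: tau_coset_pair[OF assms])
  \<comment> \<open>The two possibilities are l = 0 and l = 1; the factor tau^0 on the left brings
    the equation into the form that \<open>word_unique\<close> takes.\<close>
  then obtain l :: nat where "\<sigma> [^] nat i \<otimes> \<tau> [^] (0::nat) = \<sigma> [^] nat j \<otimes> \<tau> [^] l"
  proof (elim insertE emptyE)
    assume "\<sigma> [^] i = \<sigma> [^] j"
    then show thesis
      using that[of 0] ij by (simp add: pow_nat)
  next
    assume "\<sigma> [^] i = \<sigma> [^] j \<otimes> \<tau>"
    then show thesis
      using that[of 1] ij sigma_closed tau_closed by (simp add: pow_nat)
  qed
  from word_unique(1)[OF assms this] show "i = j"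
    using ij by (simp add: nat_less_iff eq_nat_nat_iff)
qed

lemma lcosets_tau:
  assumes "n > 0"
  shows "lcosets (generate G {\<tau>}) = tau_coset ` {0..<int n}"
proof
  show "tau_coset ` {0..<int n} \<subseteq> lcosets (generate G {\<tau>})"
    using sigma_closed by (auto simp: LCOSETS_def tau_coset_def)
  show "lcosets (generate G {\<tau>}) \<subseteq> tau_coset ` {0..<int n}"
  proof
    fix C assume "C \<in> lcosets (generate G {\<tau>})"
    then obtain g where g: "g \<in> carrier G" "C = g <#\<^bsub>G\<^esub> generate G {\<tau>}"
      by (auto simp: LCOSETS_def)
    obtain i j :: nat where ij: "g = \<sigma> [^] i \<otimes> \<tau> [^] j"
      using word_exists[OF assms g(1)] by blast
    have "\<tau> [^] j \<in> generate G {\<tau>}"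
      by (auto simp: generate_pow_on_finite_carrier[OF finite_carrier[OF assms] tau_closed])
    then have "\<tau> [^] j <#\<^bsub>G\<^esub> generate G {\<tau>} = generate G {\<tau>}"
      using coset_join3 subgroup_tau tau_closed by blast
    then have "C = tau_coset (int i)"
      using lcos_m_assoc[OF subgroup.subset[OF subgroup_tau], of "\<sigma> [^] i" "\<tau> [^] j"]
        sigma_closed tau_closed
      by (simp add: g ij tau_coset_def int_pow_int)
    then have "C = tau_coset (int i mod int n)"
      by (simp only: tau_coset_mod)
    then show "C \<in> tau_coset ` {0..<int n}"
      using assms by (intro image_eqI[of _ _ "int i mod int n"]) auto
  qed
qed

text \<open>These are c_0 and c_1 of the overview. A power of sigma crosses tau as another power of
  sigma, hence fixes both cosets; tau exchanges them because its square is trivial.\<close>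

lemma sigma_cosets:
  assumes "n > 0"
  shows "\<sigma> <#\<^bsub>G\<^esub> generate G {\<sigma>} = generate G {\<sigma>}"
    and "\<sigma> <#\<^bsub>G\<^esub> (\<tau> <#\<^bsub>G\<^esub> generate G {\<sigma>}) = \<tau> <#\<^bsub>G\<^esub> generate G {\<sigma>}"
    and "\<tau> <#\<^bsub>G\<^esub> (\<tau> <#\<^bsub>G\<^esub> generate G {\<sigma>}) = generate G {\<sigma>}"
    and "generate G {\<sigma>} \<noteq> \<tau> <#\<^bsub>G\<^esub> generate G {\<sigma>}"
    and "lcosets (generate G {\<sigma>}) = {generate G {\<sigma>}, \<tau> <#\<^bsub>G\<^esub> generate G {\<sigma>}}"
proof -
  let ?S = "generate G {\<sigma>}"
  note S = subgroup.subset[OF subgroup_sigma]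
  have pow: "\<sigma> [^] k <#\<^bsub>G\<^esub> ?S = ?S" for k :: nat
    by (rule coset_join3) (use sigma_closed subgroup_sigma generate_sigma[OF assms] in auto)
  show s: "\<sigma> <#\<^bsub>G\<^esub> ?S = ?S"
    using pow[of 1] sigma_closed by simp
  have pow_tau: "\<sigma> [^] k <#\<^bsub>G\<^esub> (\<tau> <#\<^bsub>G\<^esub> ?S) = \<tau> <#\<^bsub>G\<^esub> ?S" for k :: nat
  proof -
    \<comment> \<open>The exponent -k is brought back to a natural residue, so that
      \<open>pow\<close> can absorb the power of sigma.\<close>
    have "\<sigma> [^] k \<otimes> \<tau> = \<tau> \<otimes> \<sigma> [^] (- int k)"
      using tau_sigma_int_pow[OF assms, of "- int k"] by (simp add: int_pow_int)
    also have "\<dots> = \<tau> \<otimes> \<sigma> [^] nat ((- int k) mod int n)"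
      by (simp only: sigma_int_pow_nat[OF assms])
    finally show ?thesis
      using sigma_closed tau_closed lcos_m_assoc[OF S, of "\<sigma> [^] k" \<tau>]
        lcos_m_assoc[OF S, of \<tau> "\<sigma> [^] nat ((- int k) mod int n)"]
      by (simp add: pow)
  qed
  show "\<sigma> <#\<^bsub>G\<^esub> (\<tau> <#\<^bsub>G\<^esub> ?S) = \<tau> <#\<^bsub>G\<^esub> ?S"
    using pow_tau[of 1] sigma_closed by simp
  have "\<tau> \<otimes> \<tau> = \<one>"
    using tau_pow tau_closed by (simp add: numeral_2_eq_2)
  then show tt: "\<tau> <#\<^bsub>G\<^esub> (\<tau> <#\<^bsub>G\<^esub> ?S) = ?S"
    using lcos_m_assoc[OF S tau_closed tau_closed] lcos_mult_one[OF S] by simp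
  show "?S \<noteq> \<tau> <#\<^bsub>G\<^esub> ?S"
  proof
    assume "?S = \<tau> <#\<^bsub>G\<^esub> ?S"
    moreover have "\<tau> \<in> \<tau> <#\<^bsub>G\<^esub> ?S"
      using lcos_self[OF tau_closed subgroup_sigma] .
    ultimately have "\<tau> \<in> ?S" by simp
    then obtain k :: nat where "\<tau> = \<sigma> [^] k"
      unfolding generate_sigma[OF assms] by blast
    \<comment> \<open>Padding with zeroth powers lets uniqueness of words compare the tau-exponents
      1 and 0, which differ modulo 2.\<close>
    then have "\<sigma> [^] (0::nat) \<otimes> \<tau> [^] (1::nat) = \<sigma> [^] k \<otimes> \<tau> [^] (0::nat)"
      using tau_closed sigma_closed by simp
    from word_unique(2)[OF assms this] show False by simp
  qed
  show "lcosets ?S = {?S, \<tau> <#\<^bsub>G\<^esub> ?S}"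
  proof
    have "\<one> <#\<^bsub>G\<^esub> ?S \<in> lcosets ?S" "\<tau> <#\<^bsub>G\<^esub> ?S \<in> lcosets ?S"
      unfolding LCOSETS_def using tau_closed by blast+
    then show "{?S, \<tau> <#\<^bsub>G\<^esub> ?S} \<subseteq> lcosets ?S"
      by (simp add: lcos_mult_one[OF S])
    show "lcosets ?S \<subseteq> {?S, \<tau> <#\<^bsub>G\<^esub> ?S}"
    proof
      fix C assume "C \<in> lcosets ?S"
      then obtain g where g: "g \<in> carrier G" "C = g <#\<^bsub>G\<^esub> ?S"
        by (auto simp: LCOSETS_def)
      obtain i j :: nat where ij: "g = \<sigma> [^] i \<otimes> \<tau> [^] j"
        using word_exists[OF assms g(1)] by blast
      have "\<tau> [^] j \<in> generate G {\<tau>}"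
        by (auto simp: generate_pow_on_finite_carrier[OF finite_carrier[OF assms] tau_closed])
      then have "\<tau> [^] j = \<one> \<or> \<tau> [^] j = \<tau>"
        using generate_tau[OF assms] by blast
      then have "C = \<sigma> [^] i <#\<^bsub>G\<^esub> ?S \<or> C = \<sigma> [^] i \<otimes> \<tau> <#\<^bsub>G\<^esub> ?S"
        using sigma_closed by (elim disjE) (simp_all add: g(2) ij)
      moreover have "\<sigma> [^] i \<otimes> \<tau> <#\<^bsub>G\<^esub> ?S = \<tau> <#\<^bsub>G\<^esub> ?S"
        using lcos_m_assoc[OF S _ tau_closed, of "\<sigma> [^] i"] sigma_closed by (simp only: pow_tau nat_pow_closed)
      ultimately show "C \<in> {?S, \<tau> <#\<^bsub>G\<^esub> ?S}"
        by (simp only: pow) simp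
    qed
  qed
qed

end

section \<open>The isomorphism\<close>

lemma sum_const_frag: "(\<Sum>i\<in>I. x) = frag_cmul (int (card I)) (x :: 'b \<Rightarrow>\<^sub>0 int)"
  by (rule poly_mapping_eqI) (simp add: lookup_sum)

text \<open>The linear algebra is separated from the group: \<open>c0\<close>, \<open>c1\<close> and
  the \<open>v i\<close> are mere labels, later the two cosets of <sigma> and the n cosets of
  <tau>.\<close>

locale lattice_splitting =
  fixes n :: nat and c0 c1 :: 'c and v :: "int \<Rightarrow> 'v"
  assumes odd_n: "odd n"
    and c_distinct: "c0 \<noteq> c1"
    and inj_v: "inj_on v {0..<int n}"
begin

definition m :: int where "m = int (n div 2)"

lemma n_eq: "int n = 2 * m + 1"
  using odd_n by (auto simp: m_def elim!: oddE)

definition E :: "'c \<Rightarrow>\<^sub>0 int" where "E = frag_of c0 + frag_of c1"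

definition N :: "'v \<Rightarrow>\<^sub>0 int" where "N = (\<Sum>i\<in>{0..<int n}. frag_of (v i))"

definition P :: "basis \<Rightarrow>\<^sub>0 int" where "P = (\<Sum>i\<in>{0..<int n}. frag_of (Wi i))"

text \<open>\<open>to_c\<close> and \<open>to_v\<close> are the components of the images of basis
  vectors: v_i + z splits into \<open>E\<close> and v_i + N, and m z + N + c_0 into m E + c_0 and (m
  + 1) N.\<close>

definition to_c :: "basis \<Rightarrow> 'c \<Rightarrow>\<^sub>0 int" where
  "to_c b = (case b of Wi i \<Rightarrow> E | W \<Rightarrow> frag_cmul m E + frag_of c0)"

definition to_v :: "basis \<Rightarrow> 'v \<Rightarrow>\<^sub>0 int" where
  "to_v b = (case b of Wi i \<Rightarrow> frag_of (v i) + N | W \<Rightarrow> frag_cmul (m + 1) N)"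

definition to_perm :: "(basis \<Rightarrow>\<^sub>0 int) \<times> int \<Rightarrow> ('c \<Rightarrow>\<^sub>0 int) \<times> ('v \<Rightarrow>\<^sub>0 int)" where
  "to_perm = (\<lambda>(x, k). (frag_extend to_c x + frag_cmul k E, frag_extend to_v x + frag_cmul k N))"

text \<open>Only the part of the inverse in the lattice of rank n + 1 is recorded; the integer part
  is added in \<open>of_perm\<close>. The \<open>else\<close> branch gives every label a value
  supported in \<open>Mplus_basis n\<close>.\<close>

definition of_c :: "'c \<Rightarrow> basis \<Rightarrow>\<^sub>0 int" where
  "of_c c = (if c = c0 then frag_of W - P else - frag_of W)"

definition of_v :: "'v \<Rightarrow> basis \<Rightarrow>\<^sub>0 int" where
  "of_v d = frag_of (Wi (the_inv_into {0..<int n} v d))"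

text \<open>Coefficient sums determine the integer part of the inverse, because c_0 and c_1 each
  contribute m + 1 and each v_i contributes -1.\<close>

definition deg_c :: "('c \<Rightarrow>\<^sub>0 int) \<Rightarrow> int" where
  "deg_c y = Poly_Mapping.lookup y c0 + Poly_Mapping.lookup y c1"

definition deg_v :: "('v \<Rightarrow>\<^sub>0 int) \<Rightarrow> int" where
  "deg_v u = (\<Sum>i\<in>{0..<int n}. Poly_Mapping.lookup u (v i))"

definition of_perm :: "('c \<Rightarrow>\<^sub>0 int) \<times> ('v \<Rightarrow>\<^sub>0 int) \<Rightarrow> (basis \<Rightarrow>\<^sub>0 int) \<times> int" where
  "of_perm = (\<lambda>(y, u). (frag_extend of_c y + frag_extend of_v u, (m + 1) * deg_c y - deg_v u))"

lemma to_simps [simp]: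
  "to_c (Wi i) = E" "to_c W = frag_cmul m E + frag_of c0"
  "to_v (Wi i) = frag_of (v i) + N" "to_v W = frag_cmul (m + 1) N"
  by (simp_all add: to_c_def to_v_def)

lemma deg_simps [simp]:
  "deg_c (x + y) = deg_c x + deg_c y" "deg_c (x - y) = deg_c x - deg_c y"
  "deg_c (frag_cmul k x) = k * deg_c x" "deg_c 0 = 0"
  "deg_c (frag_of c0) = 1" "deg_c (frag_of c1) = 1" "deg_c E = 2"
  "deg_v (u + w) = deg_v u + deg_v w" "deg_v (u - w) = deg_v u - deg_v w"
  "deg_v (frag_cmul k u) = k * deg_v u" "deg_v 0 = 0"
  using c_distinct
  by (simp_all add: deg_c_def deg_v_def E_def lookup_add lookup_minus sum.distrib sum_subtractf
      algebra_simps flip: sum_distrib_left)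

lemma deg_v_frag_of [simp]: "i \<in> {0..<int n} \<Longrightarrow> deg_v (frag_of (v i)) = 1"
proof -
  assume i: "i \<in> {0..<int n}"
  have "deg_v (frag_of (v i)) = (\<Sum>j\<in>{0..<int n}. if j = i then 1 else 0)"
    unfolding deg_v_def by (rule sum.cong) (use i inj_onD[OF inj_v] in auto)
  then show ?thesis using i by simp
qed

lemma deg_v_N [simp]: "deg_v N = int n"
proof -
  have "deg_v (\<Sum>i\<in>I. frag_of (v i)) = int (card I)" if "finite I" "I \<subseteq> {0..<int n}" for I
    using that by (induction I) auto
  from this[of "{0..<int n}"] show ?thesis by (simp add: N_def)
qed

lemma of_v_frag [simp]: "i \<in> {0..<int n} \<Longrightarrow> of_v (v i) = frag_of (Wi i)"
  by (simp only: of_v_def the_inv_into_f_f[OF inj_v])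

lemma of_c_simps [simp]: "of_c c0 = frag_of W - P" "of_c c1 = - frag_of W"
  using c_distinct by (simp_all add: of_c_def)

lemma frag_extend_of_v_N [simp]: "frag_extend of_v N = P"
  unfolding N_def P_def by (subst frag_extend_sum) (auto intro!: sum.cong)

text \<open>The values w - P and -w add up to -P. This cancels the image P of \<open>N\<close>, so
  the inverse sends z into the integer summand.\<close>

lemma frag_extend_of_c_E [simp]: "frag_extend of_c E = - P"
  by (simp add: E_def frag_extend_add)

lemma frag_extend_to_c_P [simp]: "frag_extend to_c P = frag_cmul (int n) E"
  unfolding P_def by (simp add: frag_extend_sum o_def sum_const_frag)

lemma frag_extend_to_v_P [simp]: "frag_extend to_v P = N + frag_cmul (int n) N"
  unfolding P_def by (simp add: frag_extend_sum o_def sum.distrib sum_const_frag flip: N_def)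

section \<open>The two maps are mutually inverse\<close>

lemmas frag_linear = frag_extend_add frag_extend_diff frag_extend_minus frag_extend_cmul
lemmas lookup_linear = lookup_add lookup_minus lookup_frag_cmul lookup_uminus

lemma keys_linear_closed:
  "\<lbrakk>Poly_Mapping.keys x \<subseteq> B; Poly_Mapping.keys y \<subseteq> B\<rbrakk> \<Longrightarrow> Poly_Mapping.keys (x + y) \<subseteq> B"
  "\<lbrakk>Poly_Mapping.keys x \<subseteq> B; Poly_Mapping.keys y \<subseteq> B\<rbrakk> \<Longrightarrow> Poly_Mapping.keys (x - y) \<subseteq> B"
  "Poly_Mapping.keys x \<subseteq> B \<Longrightarrow> Poly_Mapping.keys (frag_cmul k x) \<subseteq> B"
  "(\<And>i. i \<in> I \<Longrightarrow> Poly_Mapping.keys (f i) \<subseteq> B) \<Longrightarrow> Poly_Mapping.keys (\<Sum>i\<in>I. f i) \<subseteq> B"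
  using keys_add[of x y] keys_diff[of x y] keys_cmul[of k x] keys_sum[of f I] by blast+

lemma of_perm_to_perm:
  assumes "Poly_Mapping.keys x \<subseteq> Mplus_basis n"
  shows "of_perm (to_perm (x, k)) = (x, k)"
proof -
  \<comment> \<open>The second conjunct says that \<open>x\<close> contributes 0 to the integer
    coordinate: for w_i both sides are 2 m + 2, for w both are (m + 1)(2 m + 1).\<close>
  have "frag_extend of_c (frag_extend to_c x) + frag_extend of_v (frag_extend to_v x) = x
      \<and> (m + 1) * deg_c (frag_extend to_c x) = deg_v (frag_extend to_v x)"
    using assms
  proof (induction rule: frag_induction)
    case (one b)
    then consider i where "i \<in> {0..<int n}" "b = Wi i" | "b = W"
      by (auto simp: Mplus_basis_def)
    then show ?case
    proof cases
      case 1
      then show ?thesis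
        by (simp add: frag_linear n_eq)
    next
      case 2
      have "frag_cmul m (- P) + (frag_of W - P) + frag_cmul (m + 1) P = frag_of W"
        by (rule poly_mapping_eqI) (simp add: lookup_linear algebra_simps)
      then show ?thesis
        using 2 by (simp add: frag_linear n_eq algebra_simps)
    qed
  next
    case (diff a b)
    then show ?case by (simp add: frag_linear algebra_simps)
  qed simp
  \<comment> \<open>The multiple k z returns as k alone: its lattice part vanishes and its integer
    part is k (2 (m + 1) - n) = k.\<close>
  moreover have "frag_extend of_c (frag_cmul k E) + frag_extend of_v (frag_cmul k N) = 0"
    by (rule poly_mapping_eqI) (simp add: frag_linear lookup_linear)
  ultimately show ?thesis
    by (simp add: to_perm_def of_perm_def frag_linear n_eq algebra_simps)
qed

text \<open>Arbitrary \<open>f\<close> and \<open>e\<close> let one rewriting serve both components,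
  with \<open>to_c\<close>, \<open>E\<close> and with \<open>to_v\<close>, \<open>N\<close>, in the
  difference step of the induction below.\<close>

lemma of_c_part_diff:
  "frag_extend f (frag_extend of_c (a - b)) + frag_cmul ((m + 1) * deg_c (a - b)) e
    = (frag_extend f (frag_extend of_c a) + frag_cmul ((m + 1) * deg_c a) e)
    - (frag_extend f (frag_extend of_c b) + frag_cmul ((m + 1) * deg_c b) e)"
  by (simp add: frag_linear right_diff_distrib frag_cmul_diff_distrib)

lemma of_v_part_diff:
  "frag_extend f (frag_extend of_v (a - b)) - frag_cmul (deg_v (a - b)) e
    = (frag_extend f (frag_extend of_v a) - frag_cmul (deg_v a) e)
    - (frag_extend f (frag_extend of_v b) - frag_cmul (deg_v b) e)"
  by (simp add: frag_linear frag_cmul_diff_distrib)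

text \<open>The contributions of \<open>y\<close> and \<open>u\<close> are followed separately: each
  returns in its own component and cancels in the other.\<close>

lemma to_perm_of_perm:
  assumes "Poly_Mapping.keys y \<subseteq> {c0, c1}" "Poly_Mapping.keys u \<subseteq> v ` {0..<int n}"
  shows "to_perm (of_perm (y, u)) = (y, u)"
proof -
  have y: "frag_extend to_c (frag_extend of_c y) + frag_cmul ((m + 1) * deg_c y) E = y
      \<and> frag_extend to_v (frag_extend of_c y) + frag_cmul ((m + 1) * deg_c y) N = 0"
    using assms(1)
  proof (induction rule: frag_induction)
    case (one c)
    then consider "c = c0" | "c = c1" by blast
    then show ?case
    proof cases
      \<comment> \<open>For c_0 the coefficient of \<open>E\<close> is m - n + (m + 1) = 0 and that
        of \<open>N\<close> is (m + 1) - (n + 1) + (m + 1) = 0.\<close>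
      case 1
      then show ?thesis
        by (auto intro!: poly_mapping_eqI
            simp: frag_linear n_eq lookup_linear algebra_simps)
    next
      case 2
      \<comment> \<open>For c_1 the first component is E - c_0, which is c_1 once \<open>E\<close>
        is unfolded.\<close>
      then show ?thesis
        by (auto intro!: poly_mapping_eqI
            simp: frag_linear n_eq lookup_linear E_def algebra_simps)
    qed
  next
    case (diff a b)
    then show ?case by (simp only: of_c_part_diff diff_self simp_thms)
  qed simp
  have u: "frag_extend to_c (frag_extend of_v u) - frag_cmul (deg_v u) E = 0
      \<and> frag_extend to_v (frag_extend of_v u) - frag_cmul (deg_v u) N = u"
    using assms(2)
  proof (induction rule: frag_induction)
    case (one d)
    then obtain i where "i \<in> {0..<int n}" "d = v i" by blast
    \<comment> \<open>v_i goes to w_i - 1 and returns as (v_i + z) - z.\<close>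
    then show ?case by (simp add:)
  next
    case (diff a b)
    then show ?case by (simp only: of_v_part_diff diff_self simp_thms)
  qed simp
  show ?thesis
    using y u by (simp add: to_perm_def of_perm_def frag_linear frag_cmul_diff_distrib)
      (simp add: algebra_simps)
qed

lemma to_perm_closed:
  assumes "Poly_Mapping.keys x \<subseteq> Mplus_basis n"
  shows "to_perm (x, k) \<in> {y. Poly_Mapping.keys y \<subseteq> {c0, c1}} \<times> {u. Poly_Mapping.keys u \<subseteq> v ` {0..<int n}}"
proof -
  have E: "Poly_Mapping.keys E \<subseteq> {c0, c1}"
    unfolding E_def by (intro keys_linear_closed) simp_all
  have N: "Poly_Mapping.keys N \<subseteq> v ` {0..<int n}"
    unfolding N_def by (intro keys_linear_closed) simp
  have "Poly_Mapping.keys (to_c b) \<subseteq> {c0, c1}" for b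
    using E by (cases b) (simp_all add: keys_linear_closed)
  moreover have "Poly_Mapping.keys (to_v b) \<subseteq> v ` {0..<int n}" if "b \<in> Mplus_basis n" for b
  proof (cases b)
    case (Wi i)
    then have "v i \<in> v ` {0..<int n}" using that by (auto simp: Mplus_basis_def)
    then show ?thesis using N Wi by (simp add: keys_linear_closed)
  qed (use N in \<open>simp add: keys_linear_closed\<close>)
  ultimately show ?thesis
    using assms E N unfolding to_perm_def
    by (simp, intro conjI keys_linear_closed frag_extend_keys[of "Mplus_basis n"]) auto
qed

lemma of_perm_closed:
  assumes "Poly_Mapping.keys u \<subseteq> v ` {0..<int n}"
  shows "Poly_Mapping.keys (fst (of_perm (y, u))) \<subseteq> Mplus_basis n"
proof -
  have P: "Poly_Mapping.keys P \<subseteq> Mplus_basis n"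
    unfolding P_def by (intro keys_linear_closed) (simp add: Mplus_basis_def)
  have W: "Poly_Mapping.keys (frag_of W) \<subseteq> Mplus_basis n"
    by (simp add: Mplus_basis_def)
  have "Poly_Mapping.keys (of_c c) \<subseteq> Mplus_basis n" for c
    using P W keys_linear_closed(2)[OF W P] by (simp add: of_c_def)
  moreover have "Poly_Mapping.keys (of_v d) \<subseteq> Mplus_basis n" if "d \<in> v ` {0..<int n}" for d
    using that by (auto simp: Mplus_basis_def)
  ultimately show ?thesis
    using assms unfolding of_perm_def
    by (simp, intro keys_linear_closed frag_extend_keys[of UNIV] frag_extend_keys[of "v ` {0..<int n}" of_v]) auto
qed

lemma to_perm_bij:
  "bij_betw to_perm ({x. Poly_Mapping.keys x \<subseteq> Mplus_basis n} \<times> UNIV)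
     ({y. Poly_Mapping.keys y \<subseteq> {c0, c1}} \<times> {u. Poly_Mapping.keys u \<subseteq> v ` {0..<int n}})"
proof (rule bij_betw_byWitness[where f' = of_perm])
  show "\<forall>p\<in>{x. Poly_Mapping.keys x \<subseteq> Mplus_basis n} \<times> UNIV. of_perm (to_perm p) = p"
    using of_perm_to_perm by auto
  show "\<forall>q\<in>{y. Poly_Mapping.keys y \<subseteq> {c0, c1}} \<times> {u. Poly_Mapping.keys u \<subseteq> v ` {0..<int n}}.
      to_perm (of_perm q) = q"
    using to_perm_of_perm by auto
next
  show "to_perm ` ({x. Poly_Mapping.keys x \<subseteq> Mplus_basis n} \<times> UNIV)
      \<subseteq> {y. Poly_Mapping.keys y \<subseteq> {c0, c1}} \<times> {u. Poly_Mapping.keys u \<subseteq> v ` {0..<int n}}"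
    using to_perm_closed by blast
  show "of_perm ` ({y. Poly_Mapping.keys y \<subseteq> {c0, c1}} \<times> {u. Poly_Mapping.keys u \<subseteq> v ` {0..<int n}})
      \<subseteq> {x. Poly_Mapping.keys x \<subseteq> Mplus_basis n} \<times> UNIV"
  proof
    fix p assume "p \<in> of_perm ` ({y. Poly_Mapping.keys y \<subseteq> {c0, c1}}
        \<times> {u. Poly_Mapping.keys u \<subseteq> v ` {0..<int n}})"
    then obtain y u where "Poly_Mapping.keys u \<subseteq> v ` {0..<int n}" "p = of_perm (y, u)"
      by blast
    then show "p \<in> {x. Poly_Mapping.keys x \<subseteq> Mplus_basis n} \<times> UNIV"
      using of_perm_closed by (simp only: mem_Times_iff mem_Collect_eq UNIV_I simp_thms)
  qed
qed

section \<open>Compatibility with addition and with the two generators\<close>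

lemma to_perm_add:
  "to_perm (x + y, j + k) = (fst (to_perm (x, j)) + fst (to_perm (y, k)),
     snd (to_perm (x, j)) + snd (to_perm (y, k)))"
  by (simp add: to_perm_def frag_linear frag_cmul_distrib algebra_simps)

text \<open>\<open>f\<close> and \<open>h\<close> stand for translation of cosets by sigma.
  Permuting labels fixes \<open>E\<close> and \<open>N\<close>, so in the images of basis vectors
  only the term v_i moves.\<close>

lemma to_perm_sigma:
  assumes "f c0 = c0" "f c1 = c1" "\<And>i. h (v i) = v ((i + 1) mod int n)"
    and x: "Poly_Mapping.keys x \<subseteq> Mplus_basis n"
  shows "to_perm (Mplus_sigma n x, k) = map_prod (frag_extend (\<lambda>c. frag_of (f c)))
           (frag_extend (\<lambda>d. frag_of (h d))) (to_perm (x, k))"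
proof -
  let ?f = "frag_extend (\<lambda>c. frag_of (f c))" and ?h = "frag_extend (\<lambda>d. frag_of (h d))"
  have E: "?f E = E"
    using assms by (simp add: E_def frag_linear)
  have N: "?h N = N"
    unfolding N_def using odd_n assms(3)
    by (intro sum_frag_of_reindex[OF bij_betw_add_one_mod]) (auto intro: Nat.gr0I)
  have "frag_extend to_c (Mplus_sigma n x) = ?f (frag_extend to_c x)
      \<and> frag_extend to_v (Mplus_sigma n x) = ?h (frag_extend to_v x)"
    using x
  proof (induction rule: frag_induction)
    case (one b)
    then show ?case
      using assms(1-3) by (cases b) (simp_all add: frag_linear E N)
  next
    case (diff a b)
    then show ?case by (simp add: frag_linear Mplus_sigma_diff)
  qed (simp add: Mplus_sigma_def)
  then show ?thesis
    by (simp add: to_perm_def frag_linear E N)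
qed

lemma to_perm_tau:
  assumes "f c0 = c1" "f c1 = c0" "\<And>i. h (v i) = v ((- i) mod int n)"
    and x: "Poly_Mapping.keys x \<subseteq> Mplus_basis n"
  shows "to_perm (Mplus_tau n x, k) = map_prod (frag_extend (\<lambda>c. frag_of (f c)))
           (frag_extend (\<lambda>d. frag_of (h d))) (to_perm (x, k))"
proof -
  let ?f = "frag_extend (\<lambda>c. frag_of (f c))" and ?h = "frag_extend (\<lambda>d. frag_of (h d))"
  have E: "?f E = E"
    using assms by (simp add: E_def frag_linear add.commute)
  have N: "?h N = N"
    unfolding N_def using odd_n assms(3)
    by (intro sum_frag_of_reindex[OF bij_betw_uminus_mod]) (auto intro: Nat.gr0I)
  \<comment> \<open>Naming the sum \<open>P\<close> makes \<open>frag_extend_to_c_P\<close> and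
    \<open>frag_extend_to_v_P\<close> applicable.\<close>
  have tau_W: "Mplus_tau n (frag_of W) = P - frag_of W"
    by (simp add: P_def)
  have "frag_extend to_c (Mplus_tau n x) = ?f (frag_extend to_c x)
      \<and> frag_extend to_v (Mplus_tau n x) = ?h (frag_extend to_v x)"
    using x
  proof (induction rule: frag_induction)
    case (one b)
    show ?case
    proof (cases b)
      case (Wi i)
      then show ?thesis
        using assms(1-3) by (simp add: frag_linear E N)
    next
      case W
      \<comment> \<open>The choice n = 2 m + 1 balances w against tau w: (n - m) E - c_0 = (m + 1) E
        - c_0 = m E + c_1, and for \<open>N\<close> the coefficient is n + 1 - (m + 1) = m +
        1.\<close>
      have "frag_cmul (int n) E - (frag_cmul m E + frag_of c0) = frag_cmul m E + frag_of c1"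
        by (rule poly_mapping_eqI) (simp add: E_def lookup_linear n_eq algebra_simps)
      moreover have "N + frag_cmul (int n) N - frag_cmul (m + 1) N = frag_cmul (m + 1) N"
        by (rule poly_mapping_eqI) (simp add: lookup_linear n_eq algebra_simps)
      ultimately show ?thesis
        using W assms(1-3) by (simp add: tau_W frag_linear E N del: Mplus_tau_basis)
    qed
  next
    case (diff a b)
    then show ?case by (simp add: frag_linear Mplus_tau_diff)
  qed (simp add: Mplus_tau_def)
  then show ?thesis
    by (simp add: to_perm_def frag_linear E N)
qed

end

theorem theorem3p4:
  fixes G :: "('g, 'r) monoid_scheme" and \<sigma> \<tau> :: 'g and n :: nat
  assumes "n \<ge> 3" and "odd n" and "dihedral_group G \<sigma> \<tau> n"
  shows "isomorphic_lattices G
           (direct_sum (Mplus_lattice G \<sigma> \<tau> n) trivial_lattice)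
           (direct_sum (permutation_lattice G (generate G {\<sigma>}))
                       (permutation_lattice G (generate G {\<tau>})))"
proof -
  interpret dihedral_group G \<sigma> \<tau> n by fact
  have n: "n > 0" using assms(1) by simp
  let ?S = "generate G {\<sigma>}" and ?T = "generate G {\<tau>}"
  let ?M = "direct_sum (Mplus_lattice G \<sigma> \<tau> n) trivial_lattice"
  let ?N = "direct_sum (permutation_lattice G ?S) (permutation_lattice G ?T)"
  interpret lattice_splitting n ?S "\<tau> <#\<^bsub>G\<^esub> ?S" tau_coset
    using assms(2) sigma_cosets(4)[OF n] inj_on_tau_coset[OF n] by unfold_locales
  have M: "group_lattice G ?M"
    by (intro group_lattice_direct_sum group_lattice_Mplus group_lattice_trivial n is_group)
  have N: "group_lattice G ?N"
    by (intro group_lattice_direct_sum group_lattice_permutation finite_carrier n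
        subgroup_sigma subgroup_tau)
  have carrier_M: "carrier ?M = {x. Poly_Mapping.keys x \<subseteq> Mplus_basis n} \<times> UNIV"
    by (auto simp: Mplus_lattice_def trivial_lattice_def)
  have carrier_N: "carrier ?N = {y. Poly_Mapping.keys y \<subseteq> {?S, \<tau> <#\<^bsub>G\<^esub> ?S}}
      \<times> {u. Poly_Mapping.keys u \<subseteq> tau_coset ` {0..<int n}}"
    by (auto simp: permutation_lattice_def sigma_cosets(5)[OF n] lcosets_tau[OF n])
  have bij: "bij_betw to_perm (carrier ?M) (carrier ?N)"
    unfolding carrier_M carrier_N by (rule to_perm_bij)
  have mult: "to_perm (p \<otimes>\<^bsub>?M\<^esub> q) = to_perm p \<otimes>\<^bsub>?N\<^esub> to_perm q" for p q
    using to_perm_add[of "fst p" "fst q" "snd p" "snd q"]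
    by (simp add: Mplus_lattice_def trivial_lattice_def permutation_lattice_def)
  \<comment> \<open>\<open>direct_sum_simps\<close> is switched off so that carriers and products
    keep the shape in which \<open>bij\<close> and \<open>mult\<close> state them.\<close>
  have "to_perm \<in> iso ?M ?N"
    using bij mult bij_betwE[OF bij] by (auto simp: iso_def hom_def simp del: direct_sum_simps)
  moreover have "to_perm (act ?M g p) = act ?N g (to_perm p)"
    if g: "g \<in> carrier G" and p: "p \<in> carrier ?M" for g p
  proof (rule equivariant_if_on_generators[OF _ _ _ _ generated _ g p])
    show "group_module G ?M" "group_module G ?N"
      using M N by (simp_all add: group_lattice.axioms(1))
    show "to_perm \<in> carrier ?M \<rightarrow> carrier ?N"
      using bij_betwE[OF bij] by blast
    show "{\<sigma>, \<tau>} \<subseteq> carrier G"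
      using sigma_closed tau_closed by simp
    fix s q assume s: "s \<in> {\<sigma>, \<tau>}" and q: "q \<in> carrier ?M"
    obtain x k where q_eq: "q = (x, k)" and x: "Poly_Mapping.keys x \<subseteq> Mplus_basis n"
      using q unfolding carrier_M by auto
    have x': "x \<in> carrier (free_Abelian_group (Mplus_basis n))"
      using x by simp
    \<comment> \<open>The integer \<open>k\<close> is carried along unchanged, since the action on
      the integer summand is trivial.\<close>
    have "to_perm (Mplus_act G \<sigma> \<tau> n s x, k) =
        map_prod (frag_extend (\<lambda>C. frag_of (s <#\<^bsub>G\<^esub> C))) (frag_extend (\<lambda>C. frag_of (s <#\<^bsub>G\<^esub> C))) (to_perm (x, k))"
    proof (cases "s = \<sigma>")
      case True
      show ?thesis
        unfolding True Mplus_act_sigma[OF n x']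
        by (rule to_perm_sigma[OF _ _ _ x]) (simp_all add: sigma_cosets[OF n] sigma_tau_coset tau_coset_mod)
    next
      case False
      then have "s = \<tau>" using s by simp
      show ?thesis
        unfolding \<open>s = \<tau>\<close> Mplus_act_tau[OF n x']
        by (rule to_perm_tau[OF _ _ _ x])
          (simp_all add: sigma_cosets[OF n] tau_tau_coset[OF n] tau_coset_mod)
    qed
    then show "to_perm (act ?M s q) = act ?N s (to_perm q)"
      by (simp add: q_eq Mplus_lattice_def trivial_lattice_def permutation_lattice_def)
  qed
  ultimately show ?thesis
    using M N unfolding isomorphic_lattices_def lattice_isomorphism_def by blast
qed

end
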